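(* Consider the generalized time-dependent Pólya urn process $(R_n,B_n)_{n\ge0}$ with non-decreasing weight function $w:\mathbb N\to(0,\infty)$ satisfying $\sum_{n\ge0}\frac1{w(n)}<\infty$, drawing sequence $(\sigma_n)_{n\ge1}$ of positive integers, and initial numbers $R_0,B_0\in\mathbb N$ of red and blue balls. Extend $w$ to $[0,\infty)$ by linear interpolation and let $\tau_n=R_0+B_0+\sigma_1+\dots+\sigma_n$. Assume that: (i) for any $\kappa>0$, $\sum_{n\ge1}\exp(-\kappa\sigma_n)<\infty$; (ii) $\displaystyle\liminf_{n\to\infty}\frac{w(\frac{\tau_n}2+\sqrt{\sigma_n})}{w(\frac{\tau_n}2)}>1$; (iii) for any $\varepsilon>0$ there exists $\delta>0$ such that for any $\gamma\ge1+\varepsilon$, $\displaystyle\liminf_{x\to\infty}\frac{w(\gamma x)}{w(x)}\ge\gamma+\delta$; (iv) there exist $\varepsilon\in(0,1)$ and $n_0$ such that for all $n\ge n_0$, $$\sum_{i=n}^\infty\frac{\sigma_{i+1}}{w((1-\varepsilon)\tau_i)}\le\frac14\sum_{i=\lfloor\varepsilon\tau_n\rfloor}^\infty\frac1{w(i)}.$$ Then $$\mathbb P(R_\infty<\infty\text{ or }B_\infty<\infty)=1.$$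
   Context: $\mathbb N=\{0,1,2,\dots\}$. Generalized time-dependent Pólya urn (GPU) process: fix a non-decreasing $w:\mathbb N\to(0,\infty)$ and a sequence $(\sigma_n)_{n\ge1}$ of positive integers. The urn initially contains $R_0$ red and $B_0$ blue balls. At step $n+1$ ($n\ge0$), $\sigma_{n+1}$ new balls are added simultaneously, each being, independently, red with probability $\frac{w(R_n)}{w(R_n)+w(B_n)}$ and blue otherwise, where $R_n,B_n$ are the numbers of red and blue balls after $n$ steps. That is, conditionally on the past up to step $n$, $R_{n+1}-R_n$ is Binomial with parameters $\sigma_{n+1}$ and $\frac{w(R_n)}{w(R_n)+w(B_n)}$, and $B_{n+1}-B_n=\sigma_{n+1}-(R_{n+1}-R_n)$; hence $R_n+B_n=\tau_n$. Set $R_\infty=\lim_n R_n$ and $B_\infty=\lim_n B_n$ in $\mathbb N\cup\{\infty\}$. *)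

theory Defs
  imports "HOL-Probability.Probability"
begin

definition lin_interp :: "(nat \<Rightarrow> real) \<Rightarrow> real \<Rightarrow> real" where
  "lin_interp w x = w (nat \<lfloor>x\<rfloor>) + (x - of_int \<lfloor>x\<rfloor>) * (w (Suc (nat \<lfloor>x\<rfloor>)) - w (nat \<lfloor>x\<rfloor>))"

definition urn_total :: "nat \<Rightarrow> nat \<Rightarrow> (nat \<Rightarrow> nat) \<Rightarrow> nat \<Rightarrow> nat" where
  "urn_total R0 B0 \<sigma> n = R0 + B0 + (\<Sum>i = 1..n. \<sigma> i)"

text \<open>
  The conditional law of the next draw given the past is stated on the atoms of the natural
  filtration, i.e. on every history of positive probability; the process takes countably many
  values, so this is the full conditional distribution. The value of \<open>\<sigma>\<close> at 0 plays no role.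
\<close>
locale gpu_process = prob_space M
  for M :: "'a measure"
    and w :: "nat \<Rightarrow> real"
    and \<sigma> :: "nat \<Rightarrow> nat"
    and R0 B0 :: nat
    and R B :: "nat \<Rightarrow> 'a \<Rightarrow> nat" +
  assumes w_pos: "\<And>n. w n > 0"
    and w_mono: "mono w"
    and \<sigma>_pos: "\<And>n. n \<ge> 1 \<Longrightarrow> \<sigma> n > 0"
    and measurable_R: "\<And>n. R n \<in> measurable M (count_space UNIV)"
    and measurable_B: "\<And>n. B n \<in> measurable M (count_space UNIV)"
    and initial: "AE x in M. R 0 x = R0 \<and> B 0 x = B0"
    and blue_increment: "\<And>n. AE x in M.
      int (B (Suc n) x) - int (B n x) = int (\<sigma> (Suc n)) - (int (R (Suc n) x) - int (R n x))"
    and red_increment: "\<And>n k r b.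
      \<P>(x in M. \<forall>i\<le>n. R i x = r i \<and> B i x = b i) > 0 \<Longrightarrow>
      \<P>(x in M. R (Suc n) x = R n x + k \<bar> \<forall>i\<le>n. R i x = r i \<and> B i x = b i)
        = pmf (binomial_pmf (\<sigma> (Suc n)) (w (r n) / (w (r n) + w (b n)))) k"

end

theory Submission
  imports Defs "HOL-Real_Asymp.Real_Asymp"
begin

text \<open>
  Call an outcome good if one colour stays bounded. By a zero-one argument it suffices that the
  conditional probability of a good outcome, given any history at a late time \<open>n\<close>, is bounded below by
  a constant \<open>c > 0\<close>. Say that red leads at time \<open>n\<close>. With probability at least a universal constant
  its next increment exceeds half of the draw by \<open>sqrt \<sigma>\<close>, and then (ii) makes the drift
  strictly favour red. By Hoeffding's inequality and (i), with probability at least 1/2 no later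
  step deviates from its mean by more than \<open>\<theta> \<sigma>\<close>; on that event the rest is deterministic, and
  by (iii) the red fraction grows past \<open>1 - \<epsilon>\<close>.

  Finally, almost surely a dominated colour stays bounded. If blue is dominated from \<open>n\<close> on and
  unbounded, then the sum of \<open>(B (Suc i) - B i) / w (B i)\<close> over \<open>i \<ge> n\<close> is at least the tail
  \<open>\<Sum>j \<ge> B n. 1 / w j\<close>, but by (iv) its conditional expectation is at most a quarter of that. So this
  event has conditional probability at most 1/4 given every late history, hence probability 0.
\<close>

subsection \<open>Zero-one argument and binomial tails\<close>

text \<open>An event of the generated sigma-algebra lies within any \<open>e\<close> of some
  \<open>D\<close> in \<open>G\<close>, measured by the symmetric difference. For such a
  \<open>D\<close>, \<open>prob A\<close> is close both to \<open>prob (A \<inter> D)\<close> and to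
  \<open>prob D\<close>, so the bound becomes \<open>prob A \<le> c * prob A\<close> in the limit.
  This approximation stands in for Levy's zero-one law.\<close>

lemma (in prob_space) null_set_if_small_on_algebra:
  assumes alg: "algebra (space M) G" and G: "G \<subseteq> sets M"
    and A: "A \<in> sigma_sets (space M) G" and c: "c < 1"
    and small: "\<And>D. D \<in> G \<Longrightarrow> prob (A \<inter> D) \<le> c * prob D"
  shows "prob A = 0"
proof -
  interpret algebra "space M" G by (fact alg)
  have GM: "sigma_sets (space M) G \<subseteq> sets M"
    using G by (rule sets.sigma_sets_subset)
  have approx: "\<exists>D\<in>G. prob ((X - D) \<union> (D - X)) < e" if "X \<in> sigma_sets (space M) G" "e > 0" for X e
    using that
  proof (induction arbitrary: e rule: sigma_sets.induct)
    case (Basic a)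
    then show ?case by (intro bexI[of _ a]) auto
  next
    case Empty
    then show ?case by (intro bexI[of _ "{}"]) auto
  next
    case (Compl a)
    then obtain D where D: "D \<in> G" "prob ((a - D) \<union> (D - a)) < e" by blast
    have "a \<subseteq> space M" using Compl GM sets.sets_into_space by blast
    moreover have "D \<subseteq> space M" using D G sets.sets_into_space by blast
    ultimately have "((space M - a) - (space M - D)) \<union> ((space M - D) - (space M - a)) = (a - D) \<union> (D - a)"
      by blast
    with D show ?case by (intro bexI[of _ "space M - D"]) auto
  next
    case (Union a)
    have am: "a i \<in> sets M" for i using Union GM by blast
    have "(\<lambda>N. prob (\<Union>i\<le>N. a i)) \<longlonglongrightarrow> prob (\<Union>N. \<Union>i\<le>N. a i)"
      using am by (intro finite_Lim_measure_incseq) (auto simp: incseq_def intro: order_trans)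
    moreover have "(\<Union>N. \<Union>i\<le>N. a i) = (\<Union>i. a i)" by auto
    ultimately have "(\<lambda>N. prob (\<Union>i\<le>N. a i)) \<longlonglongrightarrow> prob (\<Union>i. a i)" by simp
    then have "eventually (\<lambda>N. prob (\<Union>i\<le>N. a i) > prob (\<Union>i. a i) - e / 2) sequentially"
      by (rule order_tendstoD) (use \<open>e > 0\<close> in auto)
    then obtain N where N: "prob (\<Union>i\<le>N. a i) > prob (\<Union>i. a i) - e / 2"
      by (auto simp: eventually_sequentially)
    \<comment> \<open>Half of \<open>e\<close> pays for cutting the union at \<open>N\<close>; the
      other half is shared equally by the \<open>Suc N\<close> approximations.\<close>
    define d where "d = e / 2 / real (Suc N)"
    have d: "d > 0" using \<open>e > 0\<close> by (auto simp: d_def)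
    have "\<forall>i. \<exists>D\<in>G. prob ((a i - D) \<union> (D - a i)) < d" using Union d by blast
    then obtain D where D: "\<And>i. D i \<in> G" "\<And>i. prob ((a i - D i) \<union> (D i - a i)) < d" by metis
    have Dm: "D i \<in> sets M" for i using D G by blast
    let ?D = "\<Union>i\<le>N. D i"
    have "((\<Union>i. a i) - ?D) \<union> (?D - (\<Union>i. a i)) \<subseteq>
       ((\<Union>i. a i) - (\<Union>i\<le>N. a i)) \<union> (\<Union>i\<le>N. (a i - D i) \<union> (D i - a i))" by blast
    then have "prob (((\<Union>i. a i) - ?D) \<union> (?D - (\<Union>i. a i))) \<le>
        prob (((\<Union>i. a i) - (\<Union>i\<le>N. a i)) \<union> (\<Union>i\<le>N. (a i - D i) \<union> (D i - a i)))"
      by (rule finite_measure_mono) (use am Dm in auto)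
    also have "\<dots> \<le> prob ((\<Union>i. a i) - (\<Union>i\<le>N. a i)) + prob (\<Union>i\<le>N. (a i - D i) \<union> (D i - a i))"
      by (rule measure_Un_le) (use am Dm in auto)
    also have "prob ((\<Union>i. a i) - (\<Union>i\<le>N. a i)) = prob (\<Union>i. a i) - prob (\<Union>i\<le>N. a i)"
      by (rule finite_measure_Diff) (use am in auto)
    also have "prob (\<Union>i\<le>N. (a i - D i) \<union> (D i - a i)) \<le> (\<Sum>i\<le>N. prob ((a i - D i) \<union> (D i - a i)))"
      by (rule finite_measure_subadditive_finite) (use am Dm in auto)
    also have "\<dots> \<le> (\<Sum>i\<le>N. d)" using D by (intro sum_mono less_imp_le) auto
    also have "\<dots> = real (Suc N) * d" by simp
    also have "\<dots> = e / 2" unfolding d_def by (subst nonzero_mult_div_cancel_left[symmetric, of "real (Suc N)"]) (simp_all del: of_nat_Suc)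
    finally have "prob (((\<Union>i. a i) - ?D) \<union> (?D - (\<Union>i. a i))) < e" using N by simp
    moreover have "?D \<in> G" using D by (intro finite_UN) auto
    ultimately show ?case by blast
  qed
  have Am: "A \<in> sets M" using A GM by blast
  have "(1 - c) * prob A \<le> 0 + e" if "e > 0" for e
  proof -
    \<comment> \<open>The final error is \<open>1 + \<bar>c\<bar>\<close> times this distance: once
      for the part of \<open>A\<close> outside \<open>D\<close>, and \<open>\<bar>c\<bar>\<close>
      times for replacing \<open>prob D\<close> by \<open>prob A\<close>, as \<open>c\<close> may be
      negative.\<close>
    obtain D where D: "D \<in> G" "prob ((A - D) \<union> (D - A)) < e / (1 + \<bar>c\<bar>)"
      using approx[OF A, of "e / (1 + \<bar>c\<bar>)"] \<open>e > 0\<close> by (auto simp: field_simps)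
    let ?e = "prob ((A - D) \<union> (D - A))"
    have Dm: "D \<in> sets M" using D G by blast
    have 1: "prob (A - D) \<le> ?e" by (rule finite_measure_mono) (use Am Dm in auto)
    have "prob (A - D) = prob A - prob (A \<inter> D)" "prob (D - A) = prob D - prob (A \<inter> D)"
      using Am Dm finite_measure_Diff'[of A D] finite_measure_Diff'[of D A] by (auto simp: Int_commute)
    moreover have "prob (D - A) \<le> ?e" by (rule finite_measure_mono) (use Am Dm in auto)
    ultimately have "\<bar>prob D - prob A\<bar> \<le> ?e"
      using 1 measure_nonneg[of M "A - D"] measure_nonneg[of M "D - A"] by linarith
    then have "\<bar>c\<bar> * \<bar>prob D - prob A\<bar> \<le> \<bar>c\<bar> * ?e" by (rule mult_left_mono) auto
    then have "c * (prob D - prob A) \<le> \<bar>c\<bar> * ?e" using abs_ge_self[of "c * (prob D - prob A)"] by (simp add: abs_mult)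
    moreover have "prob A \<le> c * prob D + ?e"
      using small[OF D(1)] 1 \<open>prob (A - D) = _\<close> by linarith
    ultimately have "(1 - c) * prob A \<le> (1 + \<bar>c\<bar>) * ?e" by (simp add: algebra_simps)
    also have "\<dots> \<le> (1 + \<bar>c\<bar>) * (e / (1 + \<bar>c\<bar>))" using D by (intro mult_left_mono) auto
    also have "\<dots> = e" by (simp add: add_pos_nonneg)
    finally show ?thesis by simp
  qed
  then have "(1 - c) * prob A \<le> 0" by (rule field_le_epsilon)
  then show ?thesis using c measure_nonneg[of M A] by (simp add: mult_le_0_iff)
qed

section \<open>Moments, monotonicity and tails of the binomial distribution\<close>

text \<open>Conditioning on the first trial; the inductions on the number of trials below rest on
  it.\<close>

lemma expectation_binomial_pmf_Suc:
  fixes f :: "nat \<Rightarrow> real"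
  assumes p: "p \<in> {0..1}"
  shows "measure_pmf.expectation (binomial_pmf (Suc n) p) f =
    p * measure_pmf.expectation (binomial_pmf n p) (\<lambda>k. f (Suc k)) +
    (1 - p) * measure_pmf.expectation (binomial_pmf n p) f"
proof -
  have fin: "finite (set_pmf (binomial_pmf n p \<bind> (\<lambda>k. return_pmf (g k))))" for g :: "nat \<Rightarrow> nat"
    using finite_set_pmf_binomial_pmf[OF p, of n] by simp
  show ?thesis using p finite_set_pmf_binomial_pmf[OF p, of n]
    unfolding binomial_pmf_Suc[OF p]
    by (subst pmf_expectation_bind[where A = UNIV])
       (auto simp: UNIV_bool fin map_pmf_def[symmetric])
qed

text \<open>Stochastic monotonicity in the success probability: \<open>p\<close> is replaced by
  \<open>q\<close> first in the remaining \<open>n\<close> trials, by induction, and then in the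
  first trial, where a success can only raise \<open>f\<close>.\<close>

lemma expectation_binomial_pmf_mono:
  fixes f :: "nat \<Rightarrow> real"
  assumes "mono f" "0 \<le> p" "p \<le> q" "q \<le> 1"
  shows "measure_pmf.expectation (binomial_pmf n p) f \<le> measure_pmf.expectation (binomial_pmf n q) f"
  using assms(1)
proof (induction n arbitrary: f)
  case 0
  then show ?case using assms by (simp add: binomial_pmf_0)
next
  case (Suc n)
  let ?E = "\<lambda>p. measure_pmf.expectation (binomial_pmf n p)"
  have m: "mono (\<lambda>k. f (Suc k))" using Suc.prems by (auto simp: mono_def)
  have le: "?E q f \<le> ?E q (\<lambda>k. f (Suc k))"
    using Suc.prems assms by (intro integral_mono integrable_binomial_pmf) (auto simp: mono_def)
  have "p * ?E p (\<lambda>k. f (Suc k)) + (1 - p) * ?E p f \<le> p * ?E q (\<lambda>k. f (Suc k)) + (1 - p) * ?E q f"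
    using Suc.IH[OF m] Suc.IH[OF Suc.prems] assms by (intro add_mono mult_left_mono) auto
  also have "\<dots> = ?E q f + p * (?E q (\<lambda>k. f (Suc k)) - ?E q f)" by (simp add: algebra_simps)
  also have "\<dots> \<le> ?E q f + q * (?E q (\<lambda>k. f (Suc k)) - ?E q f)"
    using le assms by (intro add_left_mono mult_right_mono) auto
  also have "\<dots> = q * ?E q (\<lambda>k. f (Suc k)) + (1 - q) * ?E q f" by (simp add: algebra_simps)
  finally show ?case using assms by (simp add: expectation_binomial_pmf_Suc)
qed

text \<open>Exponential moment about \<open>a\<close>; \<open>a\<close> varies in the induction
  because a success turns it into \<open>a - 1\<close>.\<close>

lemma expectation_binomial_pmf_exp:
  assumes p: "p \<in> {0..1}"
  shows "measure_pmf.expectation (binomial_pmf n p) (\<lambda>k. exp (t * (real k - a))) =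
    exp (- t * a) * (1 - p + p * exp t) ^ n"
proof (induction n arbitrary: a)
  case 0
  then show ?case using p by (simp add: binomial_pmf_0)
next
  case (Suc n)
  have "(\<lambda>k. exp (t * (real (Suc k) - a))) = (\<lambda>k. exp (t * (real k - (a - 1))))"
    by (simp add: algebra_simps)
  moreover have "exp (- t * (a - 1)) = exp (- t * a) * exp t"
    by (simp add: algebra_simps flip: exp_add)
  ultimately have "measure_pmf.expectation (binomial_pmf (Suc n) p) (\<lambda>k. exp (t * (real k - a))) =
      p * (exp (- t * a) * exp t * (1 - p + p * exp t) ^ n) + (1 - p) * (exp (- t * a) * (1 - p + p * exp t) ^ n)"
    using Suc[of a] Suc[of "a - 1"] by (simp only: expectation_binomial_pmf_Suc[OF p])
  also have "\<dots> = exp (- t * a) * (1 - p + p * exp t) ^ Suc n"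
    by (simp only: power_Suc) algebra
  finally show ?case .
qed

text \<open>Second-moment bound for \<open>Z = exp (10 * (K - n/2) / sqrt n)\<close>: as \<open>n\<close> grows, \<open>E Z\<close> tends to
  \<open>exp (25/2)\<close> and \<open>E Z\<^sup>2\<close> to \<open>exp 50\<close>, while \<open>Z \<ge> exp 10\<close> is the event in question.\<close>
lemma binomial_pmf_half_upper_tail:
  "eventually (\<lambda>n. measure_pmf.prob (binomial_pmf n (1/2)) {k. real k \<ge> real n / 2 + sqrt (real n)} \<ge> exp (- 31)) sequentially"
proof -
  define f where "f = (\<lambda>l (n::nat). exp (- (l / sqrt n) * (n / 2)) * (1 - 1/2 + 1/2 * exp (l / sqrt n)) ^ n)"
  have "(f 10) \<longlonglongrightarrow> exp (25/2)" unfolding f_def by real_asymp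
  moreover have "2 * exp 10 < exp (25/2 :: real)"
  proof -
    have "2 * exp 10 < exp (5/2 :: real) * exp 10"
      using exp_ge_add_one_self[of "5/2 :: real"] by (intro mult_strict_right_mono) auto
    also have "\<dots> = exp (25/2)" by (simp flip: exp_add)
    finally show ?thesis .
  qed
  ultimately have 1: "eventually (\<lambda>n. f 10 n > 2 * exp 10) sequentially" by (rule order_tendstoD)
  have "(f 20) \<longlonglongrightarrow> exp 50" unfolding f_def by real_asymp
  then have 2: "eventually (\<lambda>n. f 20 n < exp 51) sequentially" by (rule order_tendstoD) simp
  show ?thesis
    using 1 2 eventually_gt_at_top[of 0]
  proof eventually_elim
    case (elim n)
    let ?p = "binomial_pmf n (1/2)" let ?E = "measure_pmf.expectation ?p"
    let ?A = "{k. real k \<ge> real n / 2 + sqrt (real n)}"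
    define Z where "Z = (\<lambda>k::nat. exp (10 / sqrt n * (real k - n / 2)))"
    \<comment> \<open>The maximiser of \<open>2 * m * exp 10 - m^2 * exp 51\<close>, with maximum
      \<open>exp (- 31)\<close>. It makes the pointwise bound \<open>pt\<close> a Paley-Zygmund
      inequality: on \<open>?A\<close> it is \<open>2 * u - u^2 \<le> 1\<close> with
      \<open>u = m * Z k\<close>, off \<open>?A\<close> the linear term is not positive.\<close>
    define m :: real where "m = exp (-41)"
    have EZ: "?E Z = f 10 n" unfolding Z_def f_def by (subst expectation_binomial_pmf_exp) auto
    have "(\<lambda>k. (Z k)^2) = (\<lambda>k. exp (20 / sqrt n * (real k - n / 2)))"
      by (simp add: Z_def power2_eq_square algebra_simps flip: exp_add)
    then have EZ2: "?E (\<lambda>k. (Z k)^2) = f 20 n" unfolding f_def by (simp only:, subst expectation_binomial_pmf_exp) auto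
    have pt: "2 * m * (Z k - exp 10) - m^2 * (Z k)^2 \<le> indicator ?A k" for k
    proof (cases "k \<in> ?A")
      case True
      have "2 * m * Z k - m^2 * (Z k)^2 \<le> 1" using zero_le_power2[of "m * Z k - 1"]
        by (simp add: power2_diff power_mult_distrib)
      moreover have "m * exp 10 > 0" by (simp add: m_def)
      ultimately show ?thesis using True by (simp add: algebra_simps)
    next
      case False
      then have "real k - n / 2 < sqrt n" by auto
      then have "Z k \<le> exp 10" using elim by (simp add: Z_def field_simps)
      then have "m * (Z k - exp 10) \<le> 0" by (simp add: m_def mult_le_0_iff)
      moreover have "m^2 * (Z k)^2 \<ge> 0" by simp
      ultimately have "2 * m * (Z k - exp 10) - m^2 * (Z k)^2 \<le> 0" by linarith
      then show ?thesis using False by simp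
    qed
    have "exp (-31) = 2 * m * exp 10 - m^2 * exp (51::real)"
      by (simp add: m_def power2_eq_square flip: exp_add)
    also have "\<dots> \<le> 2 * m * (f 10 n - exp 10) - m^2 * f 20 n"
      using elim by (intro diff_mono mult_left_mono) (auto simp: m_def)
    also have "\<dots> = ?E (\<lambda>k. 2 * m * (Z k - exp 10) - m^2 * (Z k)^2)"
      by (simp add: integrable_binomial_pmf EZ EZ2)
    also have "\<dots> \<le> ?E (indicator ?A)"
      using pt by (intro integral_mono integrable_binomial_pmf) auto
    also have "\<dots> = measure_pmf.prob ?p ?A" by simp
    finally show ?case .
  qed
qed

text \<open>The indicator of an upper set is monotone, so among \<open>p \<ge> 1/2\<close> the
  symmetric case is the worst and the constant is uniform in \<open>p\<close>.\<close>

lemma binomial_pmf_upper_tail: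
  "eventually (\<lambda>n. \<forall>p\<in>{1/2..1}. measure_pmf.prob (binomial_pmf n p) {k. real k \<ge> real n / 2 + sqrt (real n)} \<ge> exp (- 31)) sequentially"
  using binomial_pmf_half_upper_tail
proof eventually_elim
  case (elim n)
  show ?case
  proof
    fix p :: real assume p: "p \<in> {1/2..1}"
    let ?A = "{k. real k \<ge> real n / 2 + sqrt (real n)}"
    have "mono (indicator ?A :: nat \<Rightarrow> real)" by (auto simp: mono_def indicator_def)
    then have "measure_pmf.expectation (binomial_pmf n (1/2)) (indicator ?A) \<le> measure_pmf.expectation (binomial_pmf n p) (indicator ?A :: nat \<Rightarrow> real)"
      by (rule expectation_binomial_pmf_mono) (use p in auto)
    then show "exp (-31) \<le> measure_pmf.prob (binomial_pmf n p) ?A" using elim by simp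
  qed
qed

lemma binomial_pmf_reflect:
  assumes "p \<in> {0..1}" "k \<le> n"
  shows "pmf (binomial_pmf n p) (n - k) = pmf (binomial_pmf n (1 - p)) k"
  using assms by (simp add: binomial_symmetric[of k n])

lemma nn_integral_binomial_pmf:
  assumes "p \<in> {0..1}"
  shows "(\<integral>\<^sup>+k. ennreal (real k) \<partial>binomial_pmf n p) = ennreal (real n * p)"
proof -
  have "measure_pmf.expectation (binomial_pmf n p) real = real n * p"
  proof (induction n)
    case 0
    then show ?case using assms by (simp add: binomial_pmf_0)
  next
    case (Suc n)
    have "measure_pmf.expectation (binomial_pmf n p) (\<lambda>k. 1 + real k) = 1 + real n * p"
      using Suc assms by (subst Bochner_Integration.integral_add) (auto simp: integrable_binomial_pmf)
    then show ?case using Suc assms by (simp add: expectation_binomial_pmf_Suc algebra_simps)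
  qed
  then show ?thesis
    using assms by (subst nn_integral_eq_integral) (auto simp: integrable_binomial_pmf)
qed

text \<open>Hoeffding's inequality for the frequency \<open>k / n\<close>; the case
  \<open>n = 0\<close> is separate because of the division.\<close>

lemma binomial_pmf_lower_tail:
  assumes "p \<in> {0..1}" "\<theta> > 0"
  shows "measure_pmf.prob (binomial_pmf n p) {k. real k < (p - \<theta>) * real n} \<le> exp (- (2 * \<theta>\<^sup>2) * real n)"
proof (cases "n = 0")
  case False
  interpret binomial_distribution n p using assms by unfold_locales
  have "measure_pmf.prob (binomial_pmf n p) {k. real k < (p - \<theta>) * real n} \<le>
      measure_pmf.prob (binomial_pmf n p) {k. real k / real n \<le> p - \<theta>}"
    using False by (intro measure_pmf.finite_measure_mono) (auto simp: field_simps)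
  also have "\<dots> \<le> exp (-2 * n * \<theta>\<^sup>2)" using assms False by (intro prob_le') auto
  finally show ?thesis by (simp add: algebra_simps)
qed simp

subsection \<open>Conditional law of a step\<close>

text \<open>Both sides have total mass 1, so a deficit at \<open>a\<close> would need an excess
  elsewhere. A law can thus be identified from one inequality.\<close>

lemma pmf_eq_if_le:
  assumes le: "\<And>x. pmf p x \<le> pmf q x"
  shows "p = q"
proof (rule pmf_eqI)
  fix a
  have "emeasure (measure_pmf p) (- {a}) \<le> emeasure (measure_pmf q) (- {a})"
    unfolding nn_integral_pmf[symmetric] using le by (intro nn_integral_mono ennreal_leI) auto
  then have "measure_pmf.prob p (- {a}) \<le> measure_pmf.prob q (- {a})"
    by (simp add: measure_pmf.emeasure_eq_measure)
  moreover have "measure_pmf.prob r (- {a}) = 1 - pmf r a" for r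
    using measure_pmf.prob_compl[of "{a}" r] by (simp add: Compl_eq_Diff_UNIV measure_pmf_single)
  ultimately show "pmf p a = pmf q a" using le[of a] by simp
qed

lemma (in prob_space) obtain_pmf_distr:
  fixes f :: "'a \<Rightarrow> 'b :: countable"
  assumes f: "f \<in> measurable M (count_space UNIV)"
  obtains p where "measure_pmf p = distr M (count_space UNIV) f"
proof -
  interpret D: prob_space "distr M (count_space UNIV) f" using f by (rule prob_space_distr)
  have "AE x in distr M (count_space UNIV) f. measure (distr M (count_space UNIV) f) {x} \<noteq> 0"
    by (subst D.AE_support_countable) (auto intro!: exI[of _ UNIV])
  then show ?thesis
    by (intro that[of "Abs_pmf (distr M (count_space UNIV) f)"] Abs_pmf_inverse)
       (auto simp: D.prob_space_axioms)
qed

lemma pred_le_count_space [measurable (raw)]: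
  fixes f g :: "'a \<Rightarrow> nat"
  assumes [measurable]: "f \<in> measurable M (count_space UNIV)" "g \<in> measurable M (count_space UNIV)"
  shows "Measurable.pred M (\<lambda>x. f x \<le> g x)"
proof -
  have "(\<lambda>x. (f x, g x)) \<in> measurable M (count_space UNIV)" by auto
  then have "(\<lambda>x. (\<lambda>z. fst z \<le> snd z) (f x, g x)) \<in> measurable M (count_space UNIV)"
    by (rule measurable_compose) auto
  then show ?thesis by simp
qed

lemma pred_eq_count_space [measurable (raw)]:
  fixes f g :: "'a \<Rightarrow> nat"
  assumes [measurable]: "f \<in> measurable M (count_space UNIV)" "g \<in> measurable M (count_space UNIV)"
  shows "Measurable.pred M (\<lambda>x. f x = g x)"
  unfolding eq_iff by measurable

context gpu_process
begin

text \<open>The past as a list, a value in a countable type: it becomes a single discrete random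
  variable whose atoms are the conditioning events of \<open>red_increment\<close>.\<close>

definition hist :: "nat \<Rightarrow> 'a \<Rightarrow> (nat \<times> nat) list" where
  "hist n x = map (\<lambda>i. (R i x, B i x)) [0..<Suc n]"

abbreviation prob_red :: "nat \<Rightarrow> nat \<Rightarrow> real" where
  "prob_red r b \<equiv> w r / (w r + w b)"

abbreviation law_step :: "nat \<Rightarrow> nat \<Rightarrow> nat \<Rightarrow> nat pmf" where
  "law_step n r b \<equiv> binomial_pmf (\<sigma> (Suc n)) (prob_red r b)"

lemma prob_red_in: "prob_red r b \<in> {0..1}"
  using w_pos[of r] w_pos[of b] by (auto simp: divide_simps)

lemma nth_hist: "i \<le> n \<Longrightarrow> hist n x ! i = (R i x, B i x)"
  by (simp add: hist_def nth_map nth_upt del: upt_Suc)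

lemma length_hist [simp]: "length (hist n x) = Suc n"
  by (simp add: hist_def)

lemma last_hist [simp]: "last (hist n x) = (R n x, B n x)"
  by (simp add: hist_def)

lemma take_hist: "n \<le> m \<Longrightarrow> take (Suc n) (hist m x) = hist n x"
  by (simp add: hist_def take_map del: upt_Suc)

lemma hist_eq_iff: "hist n x = h \<longleftrightarrow> length h = Suc n \<and> (\<forall>i\<le>n. R i x = fst (h ! i) \<and> B i x = snd (h ! i))"
  by (auto simp: list_eq_iff_nth_eq nth_hist less_Suc_eq_le prod_eq_iff)

lemma R_meas [measurable]: "R n \<in> measurable M (count_space UNIV)" by (rule measurable_R)
lemma B_meas [measurable]: "B n \<in> measurable M (count_space UNIV)" by (rule measurable_B)

lemma hist_meas [measurable]: "hist n \<in> measurable M (count_space UNIV)"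
proof (subst measurable_count_space_eq_countable, simp, safe)
  fix h :: "(nat \<times> nat) list"
  have "hist n -` {h} \<inter> space M = {x\<in>space M. length h = Suc n \<and> (\<forall>i\<le>n. R i x = fst (h ! i) \<and> B i x = snd (h ! i))}"
    by (auto simp: hist_eq_iff nth_hist)
  also have "\<dots> \<in> sets M" by measurable
  finally show "hist n -` {h} \<inter> space M \<in> sets M" .
qed auto

text \<open>The conditional law multiplied out, which makes it valid for histories of probability 0
  as well.\<close>

lemma prob_hist_step:
  "prob {x\<in>space M. hist n x = h \<and> R (Suc n) x = fst (last h) + k} =
   prob {x\<in>space M. hist n x = h} * pmf (law_step n (fst (last h)) (snd (last h))) k"
proof (cases "prob {x\<in>space M. hist n x = h} > 0")
  case False
  then have "prob {x\<in>space M. hist n x = h} = 0" using measure_nonneg[of M] by (metis less_eq_real_def)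
  moreover have "prob {x\<in>space M. hist n x = h \<and> R (Suc n) x = fst (last h) + k} \<le> prob {x\<in>space M. hist n x = h}"
    by (intro finite_measure_mono) auto
  ultimately show ?thesis by (simp add: measure_le_0_iff)
next
  case True
  define r b where "r i = fst (h ! i)" and "b i = snd (h ! i)" for i
  have "{x\<in>space M. hist n x = h} \<noteq> {}" using True by (metis less_irrefl measure_empty)
  then have len: "length h = Suc n" by (auto simp: hist_eq_iff)
  have h: "hist n x = h \<longleftrightarrow> (\<forall>i\<le>n. R i x = r i \<and> B i x = b i)" for x
    by (simp add: hist_eq_iff len r_def b_def)
  have "last h = h ! n" using len by (subst last_conv_nth) auto
  then have l: "fst (last h) = r n" "snd (last h) = b n" by (simp_all add: r_def b_def)
  have "prob {x\<in>space M. R (Suc n) x = R n x + k \<and> hist n x = h} / prob {x\<in>space M. hist n x = h} =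
      pmf (law_step n (r n) (b n)) k"
    using red_increment[of n r b k] True by (simp add: cond_prob_def h)
  moreover have "{x\<in>space M. R (Suc n) x = R n x + k \<and> hist n x = h} =
      {x\<in>space M. hist n x = h \<and> R (Suc n) x = fst (last h) + k}"
    by (auto simp: h l)
  ultimately show ?thesis using True by (simp add: l field_simps)
qed

text \<open>Tower property: the joint law of the history and the next red count is the law of the
  history composed with the binomial kernel. All conditional estimates go through this
  identity.\<close>

lemma nn_integral_step:
  "(\<integral>\<^sup>+x. g (hist n x) (R (Suc n) x) \<partial>M) =
   (\<integral>\<^sup>+x. (\<integral>\<^sup>+k. g (hist n x) (R n x + k) \<partial>law_step n (R n x) (B n x)) \<partial>M)"
proof -
  obtain J where J: "measure_pmf J = distr M (count_space UNIV) (\<lambda>x. (hist n x, R (Suc n) x))"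
    by (rule obtain_pmf_distr[of "\<lambda>x. (hist n x, R (Suc n) x)"]) auto
  obtain H where H: "measure_pmf H = distr M (count_space UNIV) (hist n)"
    by (rule obtain_pmf_distr[of "hist n"]) auto
  define q where "q h = law_step n (fst (last h)) (snd (last h))" for h :: "(nat \<times> nat) list"
  define K where "K h = map_pmf (\<lambda>k. (h, fst (last h) + k)) (q h)" for h
  have pmfH: "pmf H h = prob {x\<in>space M. hist n x = h}" for h
    unfolding pmf.rep_eq H by (subst measure_distr) (auto intro!: arg_cong[where f = prob])
  have pmfJ: "pmf J (h, m) = prob {x\<in>space M. hist n x = h \<and> R (Suc n) x = m}" for h m
    unfolding pmf.rep_eq J by (subst measure_distr) (auto intro!: arg_cong[where f = prob])
  \<comment> \<open>An inequality between the mass functions is enough. It is trivial where red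
    would decrease, since the kernel gives such points no mass; that the process gives them none
    either then comes for free.\<close>
  have "bind_pmf H K = J"
  proof (rule pmf_eq_if_le)
    fix z :: "(nat \<times> nat) list \<times> nat"
    obtain h m where z: "z = (h, m)" by (cases z)
    have K0: "pmf (K h') (h, m) = indicator {h} h' * pmf (K h) (h, m)" for h'
      unfolding K_def by (auto simp: indicator_def pmf_eq_0_set_pmf)
    have "pmf (bind_pmf H K) z = measure_pmf.expectation H (\<lambda>h'. indicator {h} h' * pmf (K h) (h, m))"
      by (simp add: pmf_bind z K0[symmetric])
    also have "\<dots> = pmf H h * pmf (K h) (h, m)" by (simp add: measure_pmf_single)
    also have "\<dots> \<le> pmf J (h, m)"
    proof (cases "fst (last h) \<le> m")
      case True
      then obtain k where k: "m = fst (last h) + k" using le_Suc_ex by blast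
      have "pmf (K h) (h, m) = pmf (q h) k"
        unfolding K_def k by (rule pmf_map_inj') (auto simp: inj_on_def)
      then show ?thesis unfolding pmfJ pmfH q_def k using prob_hist_step[of n h k] by simp
    next
      case False
      then have "pmf (K h) (h, m) = 0" by (auto simp: K_def pmf_eq_0_set_pmf)
      then show ?thesis by simp
    qed
    finally show "pmf (bind_pmf H K) z \<le> pmf J z" by (simp add: z)
  qed
  have "(\<integral>\<^sup>+x. g (hist n x) (R (Suc n) x) \<partial>M) = (\<integral>\<^sup>+z. (case z of (h, m) \<Rightarrow> g h m) \<partial>measure_pmf J)"
    unfolding J by (subst nn_integral_distr) auto
  also have "\<dots> = (\<integral>\<^sup>+h. (\<integral>\<^sup>+k. g h (fst (last h) + k) \<partial>q h) \<partial>measure_pmf H)"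
    by (simp flip: \<open>bind_pmf H K = J\<close> add: K_def)
  also have "\<dots> = (\<integral>\<^sup>+x. (\<integral>\<^sup>+k. g (hist n x) (R n x + k) \<partial>law_step n (R n x) (B n x)) \<partial>M)"
    unfolding H by (subst nn_integral_distr) (auto simp: q_def)
  finally show ?thesis .
qed

lemma emeasure_step:
  "emeasure M {x\<in>space M. Q (hist n x) (R (Suc n) x)} =
   (\<integral>\<^sup>+x. emeasure (law_step n (R n x) (B n x)) {k. Q (hist n x) (R n x + k)} \<partial>M)"
proof -
  have "emeasure M {x\<in>space M. Q (hist n x) (R (Suc n) x)} =
      (\<integral>\<^sup>+x. indicator {x\<in>space M. Q (hist n x) (R (Suc n) x)} x \<partial>M)"
    by simp
  also have "\<dots> = (\<integral>\<^sup>+x. indicator {(h, m). Q h m} (hist n x, R (Suc n) x) \<partial>M)"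
    by (intro nn_integral_cong) (auto simp: indicator_def)
  also have "\<dots> = (\<integral>\<^sup>+x. (\<integral>\<^sup>+k. indicator {(h, m). Q h m} (hist n x, R n x + k) \<partial>law_step n (R n x) (B n x)) \<partial>M)"
    by (rule nn_integral_step[of "\<lambda>h m. indicator {(h, m). Q h m} (h, m)"])
  also have "\<dots> = (\<integral>\<^sup>+x. (\<integral>\<^sup>+k. indicator {k. Q (hist n x) (R n x + k)} k \<partial>law_step n (R n x) (B n x)) \<partial>M)"
    by (intro nn_integral_cong) (auto simp: indicator_def)
  finally show ?thesis by simp
qed

text \<open>A bound on the next draw that holds given every history in \<open>S\<close> is
  integrated over \<open>S\<close>; no conditional expectation has to be formed.\<close>

lemma prob_step_le:
  assumes "AE x in M. S (hist n x) \<longrightarrow>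
      measure_pmf.prob (law_step n (R n x) (B n x)) {k. Q (hist n x) (R n x + k)} \<le> c"
  shows "prob {x\<in>space M. S (hist n x) \<and> Q (hist n x) (R (Suc n) x)} \<le> c * prob {x\<in>space M. S (hist n x)}"
proof (cases "c \<ge> 0")
  case True
  have "emeasure M {x\<in>space M. S (hist n x) \<and> Q (hist n x) (R (Suc n) x)} =
      (\<integral>\<^sup>+x. emeasure (law_step n (R n x) (B n x)) {k. S (hist n x) \<and> Q (hist n x) (R n x + k)} \<partial>M)"
    by (rule emeasure_step[of "\<lambda>h m. S h \<and> Q h m"])
  also have "\<dots> \<le> (\<integral>\<^sup>+x. ennreal c * indicator {x\<in>space M. S (hist n x)} x \<partial>M)"
    by (rule nn_integral_mono_AE)
       (use assms AE_space in eventually_elim, auto simp: measure_pmf.emeasure_eq_measure ennreal_leI indicator_def)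
  also have "\<dots> = ennreal c * emeasure M {x\<in>space M. S (hist n x)}"
    by (rule nn_integral_cmult_indicator) measurable
  finally show ?thesis using True
    by (simp add: emeasure_eq_measure flip: ennreal_mult)
next
  \<comment> \<open>A probability cannot be at most a negative \<open>c\<close>, so \<open>S\<close>
    fails almost surely.\<close>
  case False
  have "AE x in M. \<not> S (hist n x)" using assms
    by eventually_elim (use False in \<open>auto intro: order_trans[OF measure_nonneg]\<close>)
  then have "prob {x\<in>space M. S (hist n x)} = 0" "prob {x\<in>space M. S (hist n x) \<and> Q (hist n x) (R (Suc n) x)} = 0"
    by (auto simp: prob_eq_0 elim!: eventually_mono)
  then show ?thesis by simp
qed

lemma prob_step_ge:
  assumes "AE x in M. S (hist n x) \<longrightarrow>
      measure_pmf.prob (law_step n (R n x) (B n x)) {k. Q (hist n x) (R n x + k)} \<ge> c"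
  shows "prob {x\<in>space M. S (hist n x) \<and> Q (hist n x) (R (Suc n) x)} \<ge> c * prob {x\<in>space M. S (hist n x)}"
proof -
  have c: "measure_pmf.prob p {k. \<not> Q' k} = 1 - measure_pmf.prob p {k. Q' k}" for p and Q' :: "nat \<Rightarrow> bool"
    using measure_pmf.prob_compl[of "{k. Q' k}" p] by (auto simp: Compl_eq_Diff_UNIV[symmetric] Collect_neg_eq)
  have "prob {x\<in>space M. S (hist n x) \<and> \<not> Q (hist n x) (R (Suc n) x)} \<le> (1 - c) * prob {x\<in>space M. S (hist n x)}"
    by (rule prob_step_le[where Q = "\<lambda>h m. \<not> Q h m"]) (use assms in \<open>simp add: c\<close>)
  moreover have "prob {x\<in>space M. S (hist n x)} = prob {x\<in>space M. S (hist n x) \<and> Q (hist n x) (R (Suc n) x)} +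
      prob {x\<in>space M. S (hist n x) \<and> \<not> Q (hist n x) (R (Suc n) x)}"
    by (subst finite_measure_Union[symmetric]) (auto intro!: arg_cong[where f = prob])
  ultimately show ?thesis by (simp add: algebra_simps)
qed

section \<open>Almost sure path properties and the exchange of the colours\<close>

text \<open>Increments outside the support of the binomial law have conditional probability 0, so
  the one-step estimate applies with constant 0.\<close>

lemma AE_step: "AE x in M. R n x \<le> R (Suc n) x \<and> R (Suc n) x \<le> R n x + \<sigma> (Suc n)"
proof -
  have "prob {x\<in>space M. True \<and> \<not> (fst (last (hist n x)) \<le> R (Suc n) x \<and> R (Suc n) x \<le> fst (last (hist n x)) + \<sigma> (Suc n))}
      \<le> 0 * prob {x\<in>space M. True}"
  proof (rule prob_step_le[where Q = "\<lambda>h m. \<not> (fst (last h) \<le> m \<and> m \<le> fst (last h) + \<sigma> (Suc n))"], rule AE_I2)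
    fix x
    have "set_pmf (law_step n (R n x) (B n x)) \<subseteq> {..\<sigma> (Suc n)}"
      using prob_red_in[of "R n x" "B n x"] by (auto simp: set_pmf_binomial_eq split: if_splits)
    then have "measure_pmf.prob (law_step n (R n x) (B n x)) {k. k > \<sigma> (Suc n)} = 0"
      by (auto simp: measure_pmf_zero_iff)
    then show "True \<longrightarrow> measure_pmf.prob (law_step n (R n x) (B n x))
        {k. \<not> (fst (last (hist n x)) \<le> R n x + k \<and> R n x + k \<le> fst (last (hist n x)) + \<sigma> (Suc n))} \<le> 0"
      by (simp add: not_le)
  qed
  then have "prob {x\<in>space M. \<not> (R n x \<le> R (Suc n) x \<and> R (Suc n) x \<le> R n x + \<sigma> (Suc n))} = 0"
    by (simp add: measure_le_0_iff)
  moreover have "{x\<in>space M. \<not> (R n x \<le> R (Suc n) x \<and> R (Suc n) x \<le> R n x + \<sigma> (Suc n))} \<in> sets M"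
    by measurable
  ultimately show ?thesis using AE_space by (auto simp: prob_eq_0 elim!: eventually_elim2)
qed

lemma AE_B_Suc: "AE x in M. B (Suc n) x + (R (Suc n) x - R n x) = B n x + \<sigma> (Suc n) \<and> B n x \<le> B (Suc n) x"
  using AE_step[of n] blue_increment[of n] by eventually_elim linarith

lemma AE_total: "AE x in M. R n x + B n x = urn_total R0 B0 \<sigma> n"
proof (induction n)
  case 0
  then show ?case using initial by eventually_elim (simp add: urn_total_def)
next
  case (Suc n)
  then show ?case using AE_step[of n] AE_B_Suc[of n]
    by eventually_elim (auto simp: urn_total_def)
qed

text \<open>The blue increment is \<open>\<sigma> (Suc n)\<close> minus the red one, hence binomial
  with the complementary parameter. Every one-sided result thereby holds for both colours.\<close>

lemma gpu_process_swap: "gpu_process M w \<sigma> B0 R0 B R"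
proof unfold_locales
  show "AE x in M. B 0 x = B0 \<and> R 0 x = R0" using initial by eventually_elim auto
  show "AE x in M. int (R (Suc n) x) - int (R n x) = int (\<sigma> (Suc n)) - (int (B (Suc n) x) - int (B n x))" for n
    using blue_increment[of n] by eventually_elim auto
  show "\<P>(x in M. B (Suc n) x = B n x + k \<bar> \<forall>i\<le>n. B i x = r i \<and> R i x = b i) =
      pmf (binomial_pmf (\<sigma> (Suc n)) (w (r n) / (w (r n) + w (b n)))) k"
    if pos: "\<P>(x in M. \<forall>i\<le>n. B i x = r i \<and> R i x = b i) > 0" for n k r b
  proof -
    let ?H = "\<lambda>x. \<forall>i\<le>n. R i x = b i \<and> B i x = r i"
    have H: "(\<forall>i\<le>n. B i x = r i \<and> R i x = b i) = ?H x" for x by auto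
    have pos': "prob {x\<in>space M. ?H x} > 0" using pos by (simp add: H)
    have red: "1 - prob_red (b n) (r n) = prob_red (r n) (b n)"
      using w_pos[of "r n"] w_pos[of "b n"] by (simp add: field_simps)
    have eq: "prob {x\<in>space M. B (Suc n) x = B n x + k \<and> ?H x} =
      prob {x\<in>space M. k \<le> \<sigma> (Suc n) \<and> R (Suc n) x = R n x + (\<sigma> (Suc n) - k) \<and> ?H x}"
    proof (rule prob_eq_AE)
      show "AE x in M. (B (Suc n) x = B n x + k \<and> ?H x) \<longleftrightarrow>
          (k \<le> \<sigma> (Suc n) \<and> R (Suc n) x = R n x + (\<sigma> (Suc n) - k) \<and> ?H x)"
        using AE_B_Suc[of n] AE_step[of n]
      proof eventually_elim
        case (elim x)
        then have "B (Suc n) x = B n x + k \<longleftrightarrow> k \<le> \<sigma> (Suc n) \<and> R (Suc n) x = R n x + (\<sigma> (Suc n) - k)"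
          by linarith
        then show ?case by blast
      qed
    qed measurable
    show ?thesis
    proof (cases "k \<le> \<sigma> (Suc n)")
      case True
      have "\<P>(x in M. B (Suc n) x = B n x + k \<bar> ?H x) = \<P>(x in M. R (Suc n) x = R n x + (\<sigma> (Suc n) - k) \<bar> ?H x)"
        using eq True by (simp add: cond_prob_def)
      also have "\<dots> = pmf (law_step n (b n) (r n)) (\<sigma> (Suc n) - k)"
        by (rule red_increment[OF pos'])
      also have "\<dots> = pmf (law_step n (r n) (b n)) k"
        using True prob_red_in[of "b n" "r n"] by (simp only: binomial_pmf_reflect red)
      finally show ?thesis by (simp add: H)
    next
      case False
      then have "\<P>(x in M. B (Suc n) x = B n x + k \<bar> ?H x) = 0"
        using eq by (simp add: cond_prob_def)
      then show ?thesis using False prob_red_in[of "r n" "b n"] by (simp add: H)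
    qed
  qed
qed (use w_pos w_mono \<sigma>_pos in auto)

end

subsection \<open>Deterministic amplification of a lead\<close>

lemma lin_interp_of_nat [simp]: "lin_interp w (real n) = w n"
  by (simp add: lin_interp_def)

lemma lin_interp_between:
  assumes "mono w"
  shows "w (nat \<lfloor>x\<rfloor>) \<le> lin_interp w x" "lin_interp w x \<le> w (Suc (nat \<lfloor>x\<rfloor>))"
proof -
  let ?a = "w (nat \<lfloor>x\<rfloor>)" and ?b = "w (Suc (nat \<lfloor>x\<rfloor>))"
  have ab: "?a \<le> ?b" using assms by (auto simp: mono_def)
  have f: "0 \<le> x - of_int \<lfloor>x\<rfloor>" "x - of_int \<lfloor>x\<rfloor> \<le> 1" by linarith+
  show "?a \<le> lin_interp w x" using ab f by (simp add: lin_interp_def)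
  have "(x - of_int \<lfloor>x\<rfloor>) * (?b - ?a) \<le> 1 * (?b - ?a)"
    using ab f by (intro mult_right_mono) auto
  then show "lin_interp w x \<le> ?b" by (simp add: lin_interp_def)
qed

lemma lin_interp_mono:
  assumes w: "mono w" and x: "0 \<le> x" "x \<le> y"
  shows "lin_interp w x \<le> lin_interp w y"
proof (cases "\<lfloor>x\<rfloor> = \<lfloor>y\<rfloor>")
  case True
  have "w (nat \<lfloor>y\<rfloor>) \<le> w (Suc (nat \<lfloor>y\<rfloor>))" using w by (auto simp: mono_def)
  then show ?thesis using x True by (auto simp: lin_interp_def intro!: mult_right_mono)
next
  case False
  then have "\<lfloor>x\<rfloor> < \<lfloor>y\<rfloor>" using x floor_mono[of x y] by linarith
  then have "Suc (nat \<lfloor>x\<rfloor>) \<le> nat \<lfloor>y\<rfloor>" using x by linarith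
  then have "w (Suc (nat \<lfloor>x\<rfloor>)) \<le> w (nat \<lfloor>y\<rfloor>)" using w by (auto simp: mono_def)
  then show ?thesis using lin_interp_between[OF w, of x] lin_interp_between[OF w, of y] by linarith
qed

lemma lin_interp_pos:
  assumes "mono w" "\<And>n. w n > 0"
  shows "lin_interp w x > 0"
  using lin_interp_between(1)[OF assms(1), of x] assms(2) by (rule less_le_trans[rotated])

section \<open>Growth of the leader's share along a fixed path\<close>

lemma ratio_ge_imp_fraction_ge:
  fixes a b \<rho> :: real
  assumes "a > 0" "b > 0" "\<rho> > 0" "\<rho> * b \<le> a"
  shows "\<rho> / (1 + \<rho>) \<le> a / (a + b)"
proof -
  have "\<rho> * (a + b) \<le> a * (1 + \<rho>)" using assms by (simp add: algebra_simps)
  then show ?thesis using assms by (simp add: divide_simps mult.commute)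
qed

text \<open>An advantage \<open>y\<close> of the leader is amplified: if \<open>w(\<gamma> x) \<ge> (\<gamma> + \<delta>) w(x)\<close> with
  \<open>\<gamma> = y / (1 - y)\<close>, then the leader wins the next ball with probability exceeding \<open>y\<close> by an amount that is
  uniform over \<open>y \<le> 1 - \<epsilon>\<close>.\<close>
lemma amplified_fraction:
  fixes y \<epsilon> \<delta> :: real
  assumes "0 < y" "y \<le> 1 - \<epsilon>" "0 < \<epsilon>" "\<delta> > 0"
  defines "\<rho> \<equiv> y / (1 - y) + \<delta>"
  shows "y + \<epsilon>\<^sup>2 * \<delta> / (1 + \<delta>) \<le> \<rho> / (1 + \<rho>)"
proof -
  define z where "z = 1 - y"
  have z: "z > 0" "\<epsilon> \<le> z" "z < 1" using assms by (auto simp: z_def)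
  have r: "1 + \<rho> = (1 + z * \<delta>) / z" using z by (simp add: \<rho>_def z_def field_simps)
  have zd: "1 + z * \<delta> > 0" using z assms by (simp add: add_pos_pos)
  have "\<rho> / (1 + \<rho>) = 1 - 1 / (1 + \<rho>)"
  proof -
    have "1 + \<rho> > 0" using zd z unfolding r by simp
    then show ?thesis by (simp add: field_simps)
  qed
  also have "\<dots> = 1 - z / (1 + z * \<delta>)" unfolding r by simp
  also have "\<dots> = y + z\<^sup>2 * \<delta> / (1 + z * \<delta>)"
    using zd by (simp add: z_def[symmetric] divide_simps power2_eq_square) (simp add: z_def algebra_simps)
  finally have "\<rho> / (1 + \<rho>) = y + z\<^sup>2 * \<delta> / (1 + z * \<delta>)" .
  moreover have "\<epsilon>\<^sup>2 * \<delta> / (1 + \<delta>) \<le> z\<^sup>2 * \<delta> / (1 + z * \<delta>)"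
    using z assms zd by (intro frac_le mult_mono power_mono add_left_mono mult_left_le_one_le) auto
  ultimately show ?thesis by simp
qed

text \<open>Summing the increments gives \<open>r i \<ge> q * \<tau> i - q * \<tau> m\<close>; the
  constant is absorbed by the slack \<open>q - q'\<close>, because \<open>\<tau>\<close> tends to
  infinity.\<close>

lemma eventually_ge_of_increments_ge:
  fixes \<sigma> \<tau> r :: "nat \<Rightarrow> nat"
  assumes \<tau>_Suc: "\<And>n. \<tau> (Suc n) = \<tau> n + \<sigma> (Suc n)" and \<tau>: "filterlim \<tau> at_top sequentially"
    and inc: "eventually (\<lambda>i. real (r (Suc i)) \<ge> real (r i) + q * real (\<sigma> (Suc i))) sequentially"
    and q: "q' < q" "q \<ge> 0"
  shows "eventually (\<lambda>i. real (r i) \<ge> q' * real (\<tau> i)) sequentially"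
proof -
  obtain m where m: "\<And>i. i \<ge> m \<Longrightarrow> real (r (Suc i)) \<ge> real (r i) + q * real (\<sigma> (Suc i))"
    using inc by (auto simp: eventually_sequentially)
  have *: "real (r i) \<ge> q * real (\<tau> i) - q * real (\<tau> m)" if "i \<ge> m" for i
    using that
  proof (induction i rule: dec_induct)
    case (step i)
    then show ?case using m[of i] by (simp add: \<tau>_Suc algebra_simps)
  qed simp
  have "filterlim (\<lambda>i. real (\<tau> i)) at_top sequentially"
    using \<tau> by (rule filterlim_compose[OF filterlim_real_sequentially])
  then have "eventually (\<lambda>i. real (\<tau> i) \<ge> q * real (\<tau> m) / (q - q')) sequentially"
    by (simp add: filterlim_at_top)
  then show ?thesis using eventually_ge_at_top[of m]
  proof eventually_elim
    case (elim i)
    have "(q - q') * (q * real (\<tau> m) / (q - q')) \<le> (q - q') * real (\<tau> i)"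
      using elim q by (intro mult_left_mono) auto
    then have "q * real (\<tau> m) \<le> (q - q') * real (\<tau> i)" using q by simp
    then show ?case using *[of i] elim by (simp add: algebra_simps)
  qed
qed

text \<open>A bootstrap: (ii) turns a lead of \<open>sqrt (\<sigma> n)\<close> into a winning
  probability bounded away from 1/2, and (iii) then raises the asymptotic share by a fixed amount,
  again and again. The constants \<open>\<theta>\<close> and \<open>n1\<close> are chosen before the
  path, so they are uniform over all histories.\<close>

lemma dominance_of_drift:
  fixes w :: "nat \<Rightarrow> real" and \<sigma> \<tau> :: "nat \<Rightarrow> nat"
  assumes w_pos: "\<And>n. w n > 0" and w_mono: "mono w"
    and \<tau>_Suc: "\<And>n. \<tau> (Suc n) = \<tau> n + \<sigma> (Suc n)" and \<sigma>_lim: "filterlim \<sigma> at_top sequentially"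
    and ii: "liminf (\<lambda>n. ereal (lin_interp w (real (\<tau> n) / 2 + sqrt (real (\<sigma> n))) / lin_interp w (real (\<tau> n) / 2))) > 1"
    and iii: "\<forall>\<epsilon>>0. \<exists>\<delta>>0. \<forall>\<gamma>\<ge>1 + \<epsilon>.
           Liminf at_top (\<lambda>x. ereal (lin_interp w (\<gamma> * x) / lin_interp w x)) \<ge> ereal (\<gamma> + \<delta>)"
    and \<epsilon>: "0 < \<epsilon>" "\<epsilon> < 1"
  obtains \<theta> n1 where "\<theta> > 0"
    "\<And>n r b. n \<ge> n1 \<Longrightarrow> \<forall>i\<ge>n. r i + b i = \<tau> i \<Longrightarrow>
       real (r n) \<ge> real (\<tau> n) / 2 + sqrt (real (\<sigma> n)) \<Longrightarrow>
       \<forall>i\<ge>n. real (r (Suc i)) \<ge> real (r i) + (w (r i) / (w (r i) + w (b i)) - \<theta>) * real (\<sigma> (Suc i)) \<Longrightarrow>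
       eventually (\<lambda>i. real (r i) \<ge> (1 - \<epsilon>) * real (\<tau> i)) sequentially"
proof -
  let ?W = "lin_interp w"
  have W_pos: "?W x > 0" for x using lin_interp_pos[OF w_mono w_pos] .
  have \<tau>_lim: "filterlim \<tau> at_top sequentially"
  proof -
    have "filterlim (\<lambda>n. \<sigma> (Suc n)) at_top sequentially" using \<sigma>_lim by (subst filterlim_sequentially_Suc)
    then have "filterlim (\<lambda>n. \<tau> (Suc n)) at_top sequentially"
      by (rule filterlim_at_top_mono) (auto simp: \<tau>_Suc)
    then show ?thesis by (subst (asm) filterlim_sequentially_Suc)
  qed
  have \<tau>_real: "filterlim (\<lambda>i. real (\<tau> i)) at_top sequentially"
    using \<tau>_lim by (rule filterlim_compose[OF filterlim_real_sequentially])
  obtain d where d: "1 < ereal d" "ereal d < liminf (\<lambda>n. ereal (?W (real (\<tau> n) / 2 + sqrt (real (\<sigma> n))) / ?W (real (\<tau> n) / 2)))"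
    using ereal_dense2[OF ii] by auto
  have d1: "d > 1" using d(1) by simp
  have ev1: "eventually (\<lambda>n. d * ?W (real (\<tau> n) / 2) \<le> ?W (real (\<tau> n) / 2 + sqrt (real (\<sigma> n)))) sequentially"
    using less_LiminfD[OF d(2)] by eventually_elim (use W_pos in \<open>simp add: pos_less_divide_eq less_imp_le\<close>)
  \<comment> \<open>Half of the excess of the winning probability \<open>d / (1 + d)\<close> over
    1/2.\<close>
  define c where "c = (d / (1 + d) - 1 / 2) / 2"
  have c: "c > 0" "c < 1 / 4" "d / (1 + d) = 1 / 2 + 2 * c"
    using d1 by (auto simp: c_def field_simps)
  \<comment> \<open>The odds \<open>y / (1 - y)\<close> of a share \<open>y \<ge> 1/2 + c\<close>
    are at least \<open>1 + 2 * c\<close>, so this one \<open>\<delta>\<close> serves all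
    improvements.\<close>
  obtain \<delta> where \<delta>: "\<delta> > 0" "\<And>\<gamma>. \<gamma> \<ge> 1 + 2 * c \<Longrightarrow> Liminf at_top (\<lambda>x. ereal (?W (\<gamma> * x) / ?W x)) \<ge> ereal (\<gamma> + \<delta>)"
    using iii c(1) by (metis mult_pos_pos zero_less_numeral)
  \<comment> \<open>Halving makes the bound on the lower limit strict, so that it holds
    eventually.\<close>
  define \<delta>' where "\<delta>' = \<delta> / 2"
  have \<delta>': "\<delta>' > 0" "\<delta>' < \<delta>" using \<delta> by (auto simp: \<delta>'_def)
  define \<eta> where "\<eta> = \<epsilon>\<^sup>2 * \<delta>' / (1 + \<delta>')"
  have \<eta>: "\<eta> > 0" using \<epsilon> \<delta>' by (auto simp: \<eta>_def)
  \<comment> \<open>The noise costs at most a quarter of each gain: \<open>2 * c\<close> is left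
    with \<open>3/2 * c\<close>, and \<open>\<eta>\<close> with \<open>3/4 * \<eta>\<close>.\<close>
  define \<theta> where "\<theta> = min (c / 2) (\<eta> / 4)"
  have \<theta>: "\<theta> > 0" "\<theta> \<le> c / 2" "\<theta> \<le> \<eta> / 4" using c \<eta> by (auto simp: \<theta>_def)
  have "filterlim (\<lambda>n. sqrt (real (\<sigma> n))) at_top sequentially"
    by (intro filterlim_compose[OF sqrt_at_top] filterlim_compose[OF filterlim_real_sequentially] \<sigma>_lim)
  \<comment> \<open>Equivalent to \<open>sqrt (\<sigma> n) \<le> c * \<sigma> n\<close>: the gain in
    one draw alone exceeds the lead required after it, so the lead renews itself.\<close>
  then have "eventually (\<lambda>n. sqrt (real (\<sigma> n)) \<ge> 1 / c) sequentially" by (simp add: filterlim_at_top)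
  with ev1 have "eventually (\<lambda>n. d * ?W (real (\<tau> n) / 2) \<le> ?W (real (\<tau> n) / 2 + sqrt (real (\<sigma> n))) \<and> sqrt (real (\<sigma> n)) \<ge> 1 / c) sequentially"
    by eventually_elim auto
  then obtain n1 where n1: "\<And>n. n \<ge> n1 \<Longrightarrow> d * ?W (real (\<tau> n) / 2) \<le> ?W (real (\<tau> n) / 2 + sqrt (real (\<sigma> n)))"
      "\<And>n. n \<ge> n1 \<Longrightarrow> sqrt (real (\<sigma> n)) \<ge> 1 / c"
    by (auto simp: eventually_sequentially)
  show ?thesis
  proof (rule that[OF \<theta>(1)])
    fix n and r b :: "nat \<Rightarrow> nat"
    assume n: "n \<ge> n1" and rb: "\<forall>i\<ge>n. r i + b i = \<tau> i"
      and start: "real (r n) \<ge> real (\<tau> n) / 2 + sqrt (real (\<sigma> n))"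
      and inc: "\<forall>i\<ge>n. real (r (Suc i)) \<ge> real (r i) + (w (r i) / (w (r i) + w (b i)) - \<theta>) * real (\<sigma> (Suc i))"
    have frac: "\<rho> / (1 + \<rho>) \<le> w (r i) / (w (r i) + w (b i))"
      if "i \<ge> n" "\<rho> > 0" "u \<ge> 0" "v \<ge> 0" "real (r i) \<ge> v" "u + v \<ge> real (\<tau> i)" "\<rho> * ?W u \<le> ?W v" for i \<rho> u v
    proof (rule ratio_ge_imp_fraction_ge)
      have "real (b i) \<le> u" using rb[rule_format, of i] that by linarith
      then have "w (b i) \<le> ?W u" using lin_interp_mono[OF w_mono, of "real (b i)" u] by simp
      then have "\<rho> * w (b i) \<le> \<rho> * ?W u" using that by simp
      also have "\<dots> \<le> ?W v" by fact
      also have "\<dots> \<le> w (r i)" using lin_interp_mono[OF w_mono, of v "real (r i)"] that by simp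
      finally show "\<rho> * w (b i) \<le> w (r i)" .
    qed (use w_pos that in auto)
    have incq: "real (r (Suc i)) \<ge> real (r i) + q * real (\<sigma> (Suc i))"
      if "i \<ge> n" "q + \<theta> \<le> w (r i) / (w (r i) + w (b i))" for i q
    proof -
      have "q * real (\<sigma> (Suc i)) \<le> (w (r i) / (w (r i) + w (b i)) - \<theta>) * real (\<sigma> (Suc i))"
        using that by (intro mult_right_mono) auto
      then show ?thesis using inc[rule_format, OF that(1)] by linarith
    qed
    have half: "real (r (Suc i)) \<ge> real (r i) + (1/2 + 3/2 * c) * real (\<sigma> (Suc i))"
      if "i \<ge> n" "real (r i) \<ge> real (\<tau> i) / 2 + sqrt (real (\<sigma> i))" for i
    proof (rule incq)
      have "d / (1 + d) \<le> w (r i) / (w (r i) + w (b i))"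
        using that n n1(1)[of i] d1
        by (intro frac[of i d "real (\<tau> i) / 2" "real (\<tau> i) / 2 + sqrt (real (\<sigma> i))"]) auto
      then show "1/2 + 3/2 * c + \<theta> \<le> w (r i) / (w (r i) + w (b i))" using c \<theta> by linarith
    qed fact
    have lead: "real (r i) \<ge> real (\<tau> i) / 2 + sqrt (real (\<sigma> i))" if "i \<ge> n" for i
      using that
    proof (induction i rule: dec_induct)
      case base
      then show ?case by (rule start)
    next
      case (step i)
      let ?s = "real (\<sigma> (Suc i))"
      have "1 \<le> c * sqrt ?s" using n1(2)[of "Suc i"] n step c by (simp add: divide_simps mult.commute)
      then have "sqrt ?s * 1 \<le> sqrt ?s * (c * sqrt ?s)" by (intro mult_left_mono) auto
      then have "sqrt ?s \<le> c * ?s" by (simp add: algebra_simps)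
      moreover have "(1/2 + 3/2 * c) * ?s \<ge> (1/2 + c) * ?s" using c by (intro mult_right_mono) auto
      moreover have "sqrt (real (\<sigma> i)) \<ge> 0" by simp
      moreover have "(1/2 + c) * ?s = ?s / 2 + c * ?s" by (simp add: algebra_simps)
      moreover have "real (\<tau> (Suc i)) / 2 = real (\<tau> i) / 2 + ?s / 2" by (simp add: \<tau>_Suc)
      ultimately show ?case using half[OF step.hyps(1) step.IH] step.IH by linarith
    qed
    define P where "P y \<longleftrightarrow> eventually (\<lambda>i. real (r i) \<ge> y * real (\<tau> i)) sequentially" for y
    have mono_P: "P y" if "P y'" "y \<le> y'" for y y'
      using that(1) unfolding P_def
      by eventually_elim (use that(2) in \<open>auto intro: order_trans[OF mult_right_mono]\<close>)
    have base: "P (1/2 + c)"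
      unfolding P_def
    proof (rule eventually_ge_of_increments_ge[OF \<tau>_Suc \<tau>_lim])
      show "eventually (\<lambda>i. real (r (Suc i)) \<ge> real (r i) + (1/2 + 3/2 * c) * real (\<sigma> (Suc i))) sequentially"
        using eventually_ge_at_top[of n] by eventually_elim (use half lead in auto)
    qed (use c in auto)
    have improve: "P (y + \<eta> / 2)" if y: "P y" "1/2 + c \<le> y" "y \<le> 1 - \<epsilon>" for y
      unfolding P_def
    proof (rule eventually_ge_of_increments_ge[OF \<tau>_Suc \<tau>_lim])
      define \<gamma> where "\<gamma> = y / (1 - y)"
      have y01: "0 < y" "y < 1" using y c \<epsilon> by auto
      have "(1 + 2 * c) * (1 - y) \<le> (1 + 2 * c) * (1/2 - c)" using y c by (intro mult_left_mono) auto
      also have "\<dots> \<le> 1/2 + c" using c by (simp add: algebra_simps)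
      also have "\<dots> \<le> y" by fact
      finally have \<gamma>: "\<gamma> \<ge> 1 + 2 * c" using y01 by (simp add: \<gamma>_def pos_le_divide_eq)
      have "ereal (\<gamma> + \<delta>') < Liminf at_top (\<lambda>x. ereal (?W (\<gamma> * x) / ?W x))"
        using \<delta>(2)[OF \<gamma>] \<delta>' by (intro less_le_trans[OF _ \<delta>(2)[OF \<gamma>]]) auto
      from less_LiminfD[OF this] have "eventually (\<lambda>x. (\<gamma> + \<delta>') * ?W x \<le> ?W (\<gamma> * x)) at_top"
        by eventually_elim (use W_pos in \<open>simp add: pos_less_divide_eq less_imp_le\<close>)
      \<comment> \<open>At the scale \<open>x = (1 - y) * \<tau> i\<close>, the loser is at most
        \<open>x\<close> and the leader at least \<open>\<gamma> * x = y * \<tau> i\<close>.\<close>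
      moreover have "filterlim (\<lambda>i. (1 - y) * real (\<tau> i)) at_top sequentially"
        using y01 by (intro filterlim_tendsto_pos_mult_at_top[OF tendsto_const _ \<tau>_real]) auto
      ultimately have "eventually (\<lambda>i. (\<gamma> + \<delta>') * ?W ((1 - y) * real (\<tau> i)) \<le> ?W (\<gamma> * ((1 - y) * real (\<tau> i)))) sequentially"
        by (rule eventually_compose_filterlim)
      then show "eventually (\<lambda>i. real (r (Suc i)) \<ge> real (r i) + (y + 3/4 * \<eta>) * real (\<sigma> (Suc i))) sequentially"
        using y(1) eventually_ge_at_top[of n] unfolding P_def
      proof eventually_elim
        case (elim i)
        have g: "\<gamma> * ((1 - y) * real (\<tau> i)) = y * real (\<tau> i)" using y01 by (simp add: \<gamma>_def)
        have "y * real (\<tau> i) \<le> real (\<tau> i)" using y01 by (simp add: mult_left_le_one_le)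
        then have "(\<gamma> + \<delta>') / (1 + (\<gamma> + \<delta>')) \<le> w (r i) / (w (r i) + w (b i))"
          using elim y01 \<gamma> c \<delta>' unfolding g
          by (intro frac[of i "\<gamma> + \<delta>'" "(1 - y) * real (\<tau> i)" "y * real (\<tau> i)"]) (auto simp: algebra_simps)
        moreover have "y + \<eta> \<le> (\<gamma> + \<delta>') / (1 + (\<gamma> + \<delta>'))"
          unfolding \<eta>_def \<gamma>_def by (rule amplified_fraction) (use y y01 \<epsilon> \<delta>' in auto)
        ultimately show ?case using \<theta> elim by (intro incq) auto
      qed
    qed (use \<eta> y c in auto)
    have "P (min (1 - \<epsilon>) (1/2 + c + real k * (\<eta> / 2)))" for k
    proof (induction k)
      case 0
      then show ?case using base by (auto intro: mono_P)
    next
      case (Suc k)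
      let ?y = "1/2 + c + real k * (\<eta> / 2)"
      show ?case
      proof (cases "?y \<le> 1 - \<epsilon>")
        case True
        then have "P ?y" using Suc by (simp add: min_absorb2)
        then have "P (?y + \<eta> / 2)" using True \<eta> by (intro improve) auto
        then show ?thesis by (rule mono_P) (simp add: algebra_simps add_divide_distrib)
      next
        case False
        then show ?thesis using Suc by (auto simp: min_def intro: mono_P)
      qed
    qed
    moreover obtain k where "real k * (\<eta> / 2) > 1"
      using reals_Archimedean3[of "\<eta> / 2"] \<eta> by (meson half_gt_zero)
    then have "min (1 - \<epsilon>) (1/2 + c + real k * (\<eta> / 2)) = 1 - \<epsilon>" using c \<epsilon> by simp
    ultimately have "P (1 - \<epsilon>)" by metis
    then show "eventually (\<lambda>i. real (r i) \<ge> (1 - \<epsilon>) * real (\<tau> i)) sequentially" by (simp add: P_def)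
  qed
qed

subsection \<open>Boundedness of one colour\<close>

lemma infsum_atLeast_eq_suminf:
  fixes f :: "nat \<Rightarrow> ennreal"
  shows "(\<Sum>\<^sub>\<infinity>i\<in>{n..}. f i) = (\<Sum>i. f (n + i))"
proof -
  have "(+) n ` UNIV = {n..}" by (auto simp: image_iff nat_le_iff_add)
  then have "(\<Sum>\<^sub>\<infinity>i\<in>{n..}. f i) = infsum (f \<circ> (+) n) UNIV"
    by (subst infsum_reindex[symmetric]) auto
  also have "((f \<circ> (+) n) has_sum infsum (f \<circ> (+) n) UNIV) UNIV"
    by (intro has_sum_infsum nonneg_summable_on_complete) auto
  then have "infsum (f \<circ> (+) n) UNIV = suminf (f \<circ> (+) n)"
    by (intro sums_unique has_sum_imp_sums)
  finally show ?thesis by (simp add: o_def)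
qed

text \<open>A jump from \<open>r m\<close> passes \<open>r (Suc m) - r m\<close> integers
  \<open>j \<ge> r m\<close>, and each has \<open>1 / w j \<le> 1 / w (r m)\<close>.\<close>

lemma sum_inverse_le_jumps:
  fixes w :: "nat \<Rightarrow> real" and r :: "nat \<Rightarrow> nat"
  assumes w_pos: "\<And>n. w n > 0" and w_mono: "mono w" and r: "\<And>i. i \<ge> n \<Longrightarrow> r i \<le> r (Suc i)" and "n \<le> m"
  shows "r n \<le> r m \<and> (\<Sum>j = r n..<r m. ennreal (1 / w j)) \<le> (\<Sum>i = n..<m. ennreal (real (r (Suc i) - r i) / w (r i)))"
  using \<open>n \<le> m\<close>
proof (induction m rule: dec_induct)
  case (step m)
  have "(\<Sum>j = r m..<r (Suc m). ennreal (1 / w j)) \<le> (\<Sum>j = r m..<r (Suc m). ennreal (1 / w (r m)))"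
    using w_pos w_mono by (intro sum_mono ennreal_leI divide_left_mono mult_pos_pos) (auto simp: mono_def)
  also have "\<dots> = ennreal (real (r (Suc m) - r m) / w (r m))"
    using w_pos[of "r m"] by (subst sum_ennreal) (auto simp: less_imp_le)
  finally have "(\<Sum>j = r n..<r m. ennreal (1 / w j)) + (\<Sum>j = r m..<r (Suc m). ennreal (1 / w j)) \<le>
      (\<Sum>i = n..<m. ennreal (real (r (Suc i) - r i) / w (r i))) + ennreal (real (r (Suc m) - r m) / w (r m))"
    using step by (intro add_mono) auto
  moreover have "r m \<le> r (Suc m)" using r step by auto
  ultimately show ?case using step by (simp add: sum.atLeastLessThan_concat)
qed simp

lemma infsum_inverse_le_jumps:
  fixes w :: "nat \<Rightarrow> real" and r :: "nat \<Rightarrow> nat"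
  assumes w_pos: "\<And>n. w n > 0" and w_mono: "mono w" and r: "\<And>i. i \<ge> n \<Longrightarrow> r i \<le> r (Suc i)"
    and unbdd: "\<And>K. \<exists>i. r i \<ge> K"
  shows "(\<Sum>\<^sub>\<infinity>j\<in>{r n..}. ennreal (1 / w j)) \<le> (\<Sum>i. ennreal (real (r (Suc (n + i)) - r (n + i)) / w (r (n + i))))"
    (is "_ \<le> suminf ?f")
  unfolding infsum_atLeast_eq_suminf suminf_eq_SUP[of "\<lambda>i. ennreal (1 / w (r n + i))"]
proof (rule SUP_least)
  fix K
  have "\<exists>m\<ge>n. r n + K \<le> r m"
  proof -
    \<comment> \<open>Adding the maximum over \<open>{..n}\<close> excludes an index before
      \<open>n\<close> unless \<open>r n + K = 0\<close>, when \<open>n\<close> itself is a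
      witness.\<close>
    obtain i where i: "r i \<ge> r n + K + Max (r ` {..n})" using unbdd by blast
    show ?thesis
    proof (cases "i \<ge> n")
      case True
      then show ?thesis using i by (intro exI[of _ i]) auto
    next
      case False
      then have "r i \<le> Max (r ` {..n})" by (intro Max_ge) auto
      then show ?thesis using i by (intro exI[of _ n]) auto
    qed
  qed
  then obtain m where m: "n \<le> m" "r n + K \<le> r m" by blast
  have "(\<Sum>i<K. ennreal (1 / w (r n + i))) = (\<Sum>j = r n..<r n + K. ennreal (1 / w j))"
    using sum.shift_bounds_nat_ivl[of "\<lambda>j. ennreal (1 / w j)" 0 "r n" K] by (simp add: lessThan_atLeast0 add.commute)
  also have "\<dots> \<le> (\<Sum>j = r n..<r m. ennreal (1 / w j))" using m by (intro sum_mono2) auto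
  also have "\<dots> \<le> (\<Sum>i = n..<m. ennreal (real (r (Suc i) - r i) / w (r i)))"
    using sum_inverse_le_jumps[of w n r m] w_pos w_mono r m by blast
  also have "\<dots> = (\<Sum>i<m - n. ?f i)"
    using sum.shift_bounds_nat_ivl[of "\<lambda>i. ennreal (real (r (Suc i) - r i) / w (r i))" 0 n "m - n"] m
    by (simp add: lessThan_atLeast0 add.commute)
  also have "\<dots> \<le> suminf ?f" by (rule sum_le_suminf) auto
  finally show "(\<Sum>i<K. ennreal (1 / w (r n + i))) \<le> suminf ?f" .
qed

section \<open>Limits of integer sequences in the extended naturals\<close>

lemma tendsto_enat_iff: "(\<lambda>n. enat (f n)) \<longlonglongrightarrow> enat L \<longleftrightarrow> (\<exists>N. \<forall>n\<ge>N. f n = L)"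
  by (simp add: nhds_enat filterlim_principal eventually_sequentially)

lemma tendsto_enat_infinity_iff: "(\<lambda>n. enat (f n)) \<longlonglongrightarrow> \<infinity> \<longleftrightarrow> (\<forall>m. \<exists>N. \<forall>n\<ge>N. m \<le> f n)"
proof
  assume lim: "(\<lambda>n. enat (f n)) \<longlonglongrightarrow> \<infinity>"
  show "\<forall>m. \<exists>N. \<forall>n\<ge>N. m \<le> f n"
  proof
    fix m
    show "\<exists>N. \<forall>n\<ge>N. m \<le> f n"
      using order_tendstoD(1)[OF lim, of "enat m"] by (auto simp: eventually_sequentially intro: less_imp_le)
  qed
next
  assume f: "\<forall>m. \<exists>N. \<forall>n\<ge>N. m \<le> f n"
  show "(\<lambda>n. enat (f n)) \<longlonglongrightarrow> \<infinity>"
  proof (rule order_tendstoI)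
    fix a :: enat assume "a < \<infinity>"
    then obtain k where "a = enat k" by auto
    then show "eventually (\<lambda>n. a < enat (f n)) sequentially"
      using f[rule_format, of "Suc k"] by (auto simp: eventually_sequentially Suc_le_eq)
  qed auto
qed

text \<open>The last disjunct accounts for the junk value of \<open>lim\<close> on divergent sequences.\<close>
lemma lim_enat_finite_iff:
  "lim (\<lambda>n. enat (f n)) < \<infinity> \<longleftrightarrow>
    (\<exists>L N. \<forall>n\<ge>N. f n = L) \<or>
    (\<not> (\<exists>L N. \<forall>n\<ge>N. f n = L) \<and> \<not> (\<forall>m. \<exists>N. \<forall>n\<ge>N. m \<le> f n) \<and> (THE x :: enat. False) < \<infinity>)"
proof -
  consider (fin) L where "\<exists>N. \<forall>n\<ge>N. f n = L" | (inf) "\<forall>m. \<exists>N. \<forall>n\<ge>N. m \<le> f n"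
    | (div) "\<not> (\<exists>L N. \<forall>n\<ge>N. f n = L)" "\<not> (\<forall>m. \<exists>N. \<forall>n\<ge>N. m \<le> f n)"
    by blast
  then show ?thesis
  proof cases
    case fin
    then have "lim (\<lambda>n. enat (f n)) = enat L" by (intro limI) (simp add: tendsto_enat_iff)
    then show ?thesis using fin by simp blast
  next
    case inf
    then have "lim (\<lambda>n. enat (f n)) = \<infinity>" by (intro limI) (simp add: tendsto_enat_infinity_iff)
    moreover have "\<not> (\<exists>L N. \<forall>n\<ge>N. f n = L)"
    proof safe
      fix L N assume "\<forall>n\<ge>N. f n = L"
      moreover obtain N' where "\<forall>n\<ge>N'. Suc L \<le> f n" using inf by blast
      ultimately show False by (metis max.cobounded1 max.cobounded2 not_less_eq_eq order_refl)
    qed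
    ultimately show ?thesis using inf by simp
  next
    case div
    have "\<not> (\<lambda>n. enat (f n)) \<longlonglongrightarrow> l" for l
      using div by (cases l) (auto simp: tendsto_enat_iff tendsto_enat_infinity_iff)
    then have lim: "lim (\<lambda>n. enat (f n)) = (THE x. False)" by (simp add: lim_def)
    show ?thesis unfolding lim using div by blast
  qed
qed

lemma lim_enat_finite_if_bounded:
  assumes "\<And>n. f n \<le> f (Suc n)" "\<And>n. f n < K"
  shows "lim (\<lambda>n. enat (f n)) < \<infinity>"
proof -
  have m: "mono f" using assms(1) by (auto simp: mono_iff_le_Suc)
  have fin: "finite (range f)" using assms(2) by (intro finite_subset[of "range f" "{..<K}"]) auto
  then obtain N where "f N = Max (range f)" using Max_in[of "range f"] by (metis UNIV_not_empty image_is_empty rangeE)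
  then have "\<forall>n\<ge>N. f n = f N" using fin m by (metis Max_ge antisym monoD rangeI)
  then show ?thesis unfolding lim_enat_finite_iff by blast
qed

context gpu_process
begin

section \<open>The algebra of events decided in finite time\<close>

text \<open>The time \<open>n\<close> is not fixed: this is the union of the history sigma-algebras
  of all times, an algebra that generates the sigma-algebra of the whole process.\<close>

definition hist_events :: "'a set set" where
  "hist_events = {{x\<in>space M. S (hist n x)} |n S. True}"

lemma hist_eventsI: "(\<And>x. P x \<longleftrightarrow> S (hist n x)) \<Longrightarrow> {x\<in>space M. P x} \<in> hist_events"
  unfolding hist_events_def by auto

lemma hist_events_take:
  "n \<le> m \<Longrightarrow> {x\<in>space M. S (hist n x)} = {x\<in>space M. S (take (Suc n) (hist m x))}"
  by (simp add: take_hist)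

lemma algebra_hist_events: "algebra (space M) hist_events"
  unfolding algebra_iff_Int
proof (intro conjI ballI)
  show "hist_events \<subseteq> Pow (space M)" by (auto simp: hist_events_def)
  show "{} \<in> hist_events" using hist_eventsI[of "\<lambda>_. False" "\<lambda>_. False"] by simp
  fix a assume "a \<in> hist_events"
  then obtain n S where a: "a = {x\<in>space M. S (hist n x)}" by (auto simp: hist_events_def)
  have "space M - a = {x\<in>space M. \<not> S (hist n x)}" by (auto simp: a)
  then show "space M - a \<in> hist_events" using hist_eventsI[of _ "\<lambda>h. \<not> S h" n] by simp
  fix b assume "b \<in> hist_events"
  then obtain m S' where b: "b = {x\<in>space M. S' (hist m x)}" by (auto simp: hist_events_def)
  have "a \<inter> b = {x\<in>space M. S (take (Suc n) (hist (max n m) x)) \<and> S' (take (Suc m) (hist (max n m) x))}"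
    by (auto simp: a b take_hist)
  then show "a \<inter> b \<in> hist_events"
    using hist_eventsI[of _ "\<lambda>h. S (take (Suc n) h) \<and> S' (take (Suc m) h)" "max n m"] by simp
qed

lemma hist_events_sets: "hist_events \<subseteq> sets M"
  by (auto simp: hist_events_def)

text \<open>A history event can be restated at any later time by taking a prefix, so the bound is
  needed only from \<open>n1\<close> on.\<close>

lemma null_event_if_small_given_hist:
  assumes A: "A \<in> sigma_sets (space M) hist_events" and "c < 1"
    and small: "\<And>n S. n \<ge> n1 \<Longrightarrow>
      prob (A \<inter> {x\<in>space M. S (hist n x)}) \<le> c * prob {x\<in>space M. S (hist n x)}"
  shows "prob A = 0"
proof (rule null_set_if_small_on_algebra[OF algebra_hist_events hist_events_sets A \<open>c < 1\<close>])
  fix D assume "D \<in> hist_events"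
  then obtain n S where "D = {x\<in>space M. S (hist n x)}" by (auto simp: hist_events_def)
  then have "D = {x\<in>space M. S (take (Suc n) (hist (max n n1) x))}"
    using hist_events_take[of n "max n n1" S] by simp
  then show "prob (A \<inter> D) \<le> c * prob D"
    using small[of "max n n1" "\<lambda>h. S (take (Suc n) h)"] by simp
qed

text \<open>Measurability with respect to the history sigma-algebra instead of \<open>M\<close>,
  which lets events about whole paths enter the zero-one argument.\<close>

lemma measurable_hist_events:
  shows "R i \<in> measurable (sigma (space M) hist_events) (count_space UNIV)"
    and "B i \<in> measurable (sigma (space M) hist_events) (count_space UNIV)"
proof -
  have *: "(\<lambda>x. f (hist i x)) \<in> measurable (sigma (space M) hist_events) (count_space UNIV)" for f :: "_ \<Rightarrow> nat"
  proof (rule measurableI)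
    fix X :: "nat set"
    have "{x\<in>space M. f (hist i x) \<in> X} \<in> hist_events" by (rule hist_eventsI[of _ "\<lambda>h. f h \<in> X"]) simp
    moreover have "(\<lambda>x. f (hist i x)) -` X \<inter> space (sigma (space M) hist_events) = {x\<in>space M. f (hist i x) \<in> X}"
      by (auto simp: space_measure_of_conv)
    moreover have "hist_events \<subseteq> sets (sigma (space M) hist_events)"
      using hist_events_sets sets.space_closed by (subst sets_measure_of) (auto intro: sigma_sets.Basic)
    ultimately show "(\<lambda>x. f (hist i x)) -` X \<inter> space (sigma (space M) hist_events) \<in> sets (sigma (space M) hist_events)"
      by auto
  qed auto
  show "R i \<in> measurable (sigma (space M) hist_events) (count_space UNIV)"
    using *[of "\<lambda>h. fst (last h)"] by simp
  show "B i \<in> measurable (sigma (space M) hist_events) (count_space UNIV)"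
    using *[of "\<lambda>h. snd (last h)"] by simp
qed

lemma sigma_hist_events:
  "sets (sigma (space M) hist_events) = sigma_sets (space M) hist_events"
  "space (sigma (space M) hist_events) = space M"
  using hist_events_sets sets.space_closed by (auto simp: space_measure_of_conv intro!: sets_measure_of)

section \<open>Probability of domination, and boundedness of a dominated colour\<close>

lemma borel_measurable_hist_step:
  "(\<lambda>x. g (hist i x) (R (Suc i) x)) \<in> borel_measurable M"
proof -
  have "(\<lambda>x. (hist i x, R (Suc i) x)) \<in> measurable M (count_space UNIV)" by auto
  then have "(\<lambda>x. (\<lambda>z. g (fst z) (snd z)) (hist i x, R (Suc i) x)) \<in> borel_measurable M"
    by (rule measurable_compose) auto
  then show ?thesis by simp
qed

text \<open>Starting from \<open>n\<close>, going to infinity costs the loser the whole of \<open>\<Sum>j\<ge>R n. 1 / w j\<close>, of which it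
  spends in expectation at most \<open>\<sigma> / w (B i)\<close> at step \<open>i\<close>.\<close>
lemma prob_dominated_unbounded:
  defines "\<tau> \<equiv> urn_total R0 B0 \<sigma>"
  assumes \<epsilon>: "0 < \<epsilon>" "\<epsilon> < 1" and summ: "summable (\<lambda>n. 1 / w n)"
    and iv: "\<And>n. n \<ge> n0 \<Longrightarrow> (\<Sum>\<^sub>\<infinity>i\<in>{n..}. ennreal (real (\<sigma> (Suc i)) / lin_interp w ((1 - \<epsilon>) * real (\<tau> i))))
             \<le> ennreal (1 / 4) * (\<Sum>\<^sub>\<infinity>i\<in>{nat \<lfloor>\<epsilon> * real (\<tau> n)\<rfloor>..}. ennreal (1 / w i))"
  shows "prob {x\<in>space M. (\<forall>i\<ge>N. real (B i x) \<ge> (1 - \<epsilon>) * real (\<tau> i)) \<and> (\<forall>m. \<exists>i. R i x \<ge> m)} = 0"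
    (is "prob ?A = 0")
proof (rule null_event_if_small_given_hist)
  show "?A \<in> sigma_sets (space M) hist_events"
  proof -
    note [measurable] = measurable_hist_events
    have "{x\<in>space (sigma (space M) hist_events). (\<forall>i\<ge>N. real (B i x) \<ge> (1 - \<epsilon>) * real (\<tau> i)) \<and> (\<forall>m. \<exists>i. R i x \<ge> m)}
        \<in> sets (sigma (space M) hist_events)"
      by measurable
    then show ?thesis by (simp add: sigma_hist_events)
  qed
  show "(1 / 4 :: real) < 1" by simp
  fix n S assume n: "n \<ge> max N n0"
  let ?D = "{x\<in>space M. S (hist n x)}"
  let ?W = "lin_interp w"
  define F where "F = (\<Sum>\<^sub>\<infinity>i\<in>{nat \<lfloor>\<epsilon> * real (\<tau> n)\<rfloor>..}. ennreal (1 / w i))"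
  define a where "a i = ennreal (real (\<sigma> (Suc i)) / ?W ((1 - \<epsilon>) * real (\<tau> i)))" for i
  \<comment> \<open>Step \<open>i\<close> is charged only if blue dominates at time
    \<open>i\<close>, which is known before the draw; requiring domination at all times would not be
    a condition on the past.\<close>
  define g where "g i h m = (if S (take (Suc n) h) \<and> real (snd (last h)) \<ge> (1 - \<epsilon>) * real (\<tau> i)
      then ennreal (real (m - fst (last h)) / w (fst (last h))) else 0)" for i m and h :: "(nat \<times> nat) list"
  \<comment> \<open>Finiteness and positivity of \<open>F\<close> allow it to be cancelled at the
    end.\<close>
  have F_fin: "F < \<infinity>"
  proof -
    have "summable (\<lambda>i. 1 / w (nat \<lfloor>\<epsilon> * real (\<tau> n)\<rfloor> + i))"
      using summable_ignore_initial_segment[OF summ, of "nat \<lfloor>\<epsilon> * real (\<tau> n)\<rfloor>"] by (simp add: add.commute)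
    then show ?thesis
      unfolding F_def infsum_atLeast_eq_suminf using w_pos by (subst suminf_ennreal2) (auto simp: less_imp_le)
  qed
  have F_pos: "F > 0"
  proof -
    have "0 < ennreal (1 / w (nat \<lfloor>\<epsilon> * real (\<tau> n)\<rfloor> + 0))" using w_pos by simp
    also have "\<dots> \<le> F" unfolding F_def infsum_atLeast_eq_suminf
      using sum_le_suminf[of "\<lambda>i. ennreal (1 / w (nat \<lfloor>\<epsilon> * real (\<tau> n)\<rfloor> + i))" "{0}"] by simp
    finally show ?thesis .
  qed
  have step: "(\<integral>\<^sup>+x. g i (hist i x) (R (Suc i) x) \<partial>M) \<le> a i * emeasure M ?D" if "i \<ge> n" for i
  proof -
    have "(\<integral>\<^sup>+x. g i (hist i x) (R (Suc i) x) \<partial>M) =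
        (\<integral>\<^sup>+x. (\<integral>\<^sup>+k. g i (hist i x) (R i x + k) \<partial>law_step i (R i x) (B i x)) \<partial>M)"
      by (rule nn_integral_step)
    also have "\<dots> \<le> (\<integral>\<^sup>+x. a i * indicator ?D x \<partial>M)"
    proof (rule nn_integral_mono)
      fix x assume x: "x \<in> space M"
      show "(\<integral>\<^sup>+k. g i (hist i x) (R i x + k) \<partial>law_step i (R i x) (B i x)) \<le> a i * indicator ?D x"
      proof (cases "S (hist n x) \<and> real (B i x) \<ge> (1 - \<epsilon>) * real (\<tau> i)")
        case True
        let ?r = "w (R i x)" and ?b = "w (B i x)"
        have pos: "?r > 0" "?b > 0" using w_pos by auto
        have "(\<integral>\<^sup>+k. g i (hist i x) (R i x + k) \<partial>law_step i (R i x) (B i x)) =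
            (\<integral>\<^sup>+k. ennreal (1 / ?r) * ennreal (real k) \<partial>law_step i (R i x) (B i x))"
          using True that pos by (intro nn_integral_cong) (simp add: g_def take_hist flip: ennreal_mult)
        also have "\<dots> = ennreal (1 / ?r) * ennreal (real (\<sigma> (Suc i)) * prob_red (R i x) (B i x))"
          using prob_red_in by (subst nn_integral_cmult) (auto simp: nn_integral_binomial_pmf)
        \<comment> \<open>The red weight cancels: the mean increment is proportional to the weight
          by which the cost divides.\<close>
        also have "\<dots> = ennreal (real (\<sigma> (Suc i)) / (?r + ?b))"
          using pos by (simp flip: ennreal_mult)
        also have "\<dots> \<le> a i"
          unfolding a_def
        proof (intro ennreal_leI divide_left_mono mult_pos_pos)
          have "?W ((1 - \<epsilon>) * real (\<tau> i)) \<le> ?W (real (B i x))"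
            using True \<epsilon> by (intro lin_interp_mono[OF w_mono]) auto
          then show "?W ((1 - \<epsilon>) * real (\<tau> i)) \<le> ?r + ?b" using pos by simp
        qed (use pos lin_interp_pos[OF w_mono w_pos] in auto)
        finally show ?thesis using True x by simp
      next
        case False
        then have "g i (hist i x) (R i x + k) = 0" for k using that by (auto simp: g_def take_hist)
        then show ?thesis by simp
      qed
    qed
    also have "\<dots> = a i * emeasure M ?D" by (rule nn_integral_cmult_indicator) measurable
    finally show ?thesis .
  qed
  have meas: "?A \<inter> ?D \<in> sets M" by measurable
  have R_mono: "AE x in M. \<forall>i. R i x \<le> R (Suc i) x"
    unfolding AE_all_countable using AE_step by (auto elim!: eventually_mono)
  have "F * emeasure M (?A \<inter> ?D) = (\<integral>\<^sup>+x. F * indicator (?A \<inter> ?D) x \<partial>M)"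
    using meas by (simp add: nn_integral_cmult_indicator)
  also have "\<dots> \<le> (\<integral>\<^sup>+x. (\<Sum>i. g (n + i) (hist (n + i) x) (R (Suc (n + i)) x)) \<partial>M)"
  proof (rule nn_integral_mono_AE)
    show "AE x in M. F * indicator (?A \<inter> ?D) x \<le> (\<Sum>i. g (n + i) (hist (n + i) x) (R (Suc (n + i)) x))"
      using R_mono AE_total[of n]
    proof eventually_elim
      case (elim x)
      show ?case
      proof (cases "x \<in> ?A \<inter> ?D")
        case True
        have dom: "real (B i x) \<ge> (1 - \<epsilon>) * real (\<tau> i)" if "i \<ge> n" for i using True n that by auto
        have "real (R n x) + real (B n x) = real (\<tau> n)" using elim(2) by (metis \<tau>_def of_nat_add)
        then have "real (R n x) \<le> \<epsilon> * real (\<tau> n)" using dom[of n] by (simp add: algebra_simps)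
        \<comment> \<open>Red thus has to cross every level counted in \<open>F\<close>.\<close>
        then have "R n x \<le> nat \<lfloor>\<epsilon> * real (\<tau> n)\<rfloor>" by linarith
        then have "F \<le> (\<Sum>\<^sub>\<infinity>i\<in>{R n x..}. ennreal (1 / w i))"
          unfolding F_def by (intro infsum_mono_neutral nonneg_summable_on_complete) auto
        also have "\<dots> \<le> (\<Sum>i. ennreal (real (R (Suc (n + i)) x - R (n + i) x) / w (R (n + i) x)))"
          using infsum_inverse_le_jumps[of w n "\<lambda>i. R i x"] w_pos w_mono elim True by auto
        also have "\<dots> = (\<Sum>i. g (n + i) (hist (n + i) x) (R (Suc (n + i)) x))"
          using True dom by (simp add: g_def take_hist)
        finally show ?thesis using True by simp
      qed simp
    qed
  qed
  also have "\<dots> = (\<Sum>i. \<integral>\<^sup>+x. g (n + i) (hist (n + i) x) (R (Suc (n + i)) x) \<partial>M)"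
    by (rule nn_integral_suminf) (rule borel_measurable_hist_step)
  also have "\<dots> \<le> (\<Sum>i. a (n + i) * emeasure M ?D)"
    using step by (intro suminf_le) auto
  also have "\<dots> = (\<Sum>\<^sub>\<infinity>i\<in>{n..}. a i) * emeasure M ?D"
    by (simp add: infsum_atLeast_eq_suminf)
  also have "\<dots> \<le> (ennreal (1 / 4) * F) * emeasure M ?D"
    using iv[of n] n unfolding a_def F_def by (intro mult_right_mono) auto
  also have "\<dots> = F * ennreal (1 / 4 * prob ?D)"
    by (subst ennreal_mult) (auto simp: emeasure_eq_measure mult_ac)
  finally have "ennreal (prob (?A \<inter> ?D)) \<le> ennreal (1 / 4 * prob ?D)"
    using F_pos F_fin by (simp add: ennreal_mult_le_mult_iff emeasure_eq_measure)
  then show "prob (?A \<inter> ?D) \<le> 1 / 4 * prob ?D" by (subst (asm) ennreal_le_iff) auto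
qed

text \<open>The leader jumps ahead by \<open>sqrt \<sigma>\<close> in one step; from then on the drift wins unless one of the later
  steps deviates from its mean by \<open>\<theta> \<sigma>\<close>.\<close>
lemma prob_dominance_ge:
  defines "\<tau> \<equiv> urn_total R0 B0 \<sigma>"
  assumes \<theta>: "\<theta> > 0"
    and drift: "\<And>m r b. m \<ge> n \<Longrightarrow> \<forall>i\<ge>m. r i + b i = \<tau> i \<Longrightarrow>
       real (r m) \<ge> real (\<tau> m) / 2 + sqrt (real (\<sigma> m)) \<Longrightarrow>
       \<forall>i\<ge>m. real (r (Suc i)) \<ge> real (r i) + (w (r i) / (w (r i) + w (b i)) - \<theta>) * real (\<sigma> (Suc i)) \<Longrightarrow>
       eventually (\<lambda>i. real (r i) \<ge> (1 - \<epsilon>) * real (\<tau> i)) sequentially"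
    and tail: "\<And>p. p \<in> {1/2..1} \<Longrightarrow> measure_pmf.prob (binomial_pmf (\<sigma> (Suc n)) p)
        {k. real k \<ge> real (\<sigma> (Suc n)) / 2 + sqrt (real (\<sigma> (Suc n)))} \<ge> exp (- 31)"
    and summ: "summable (\<lambda>i. exp (- (2 * \<theta>\<^sup>2) * real (\<sigma> (Suc (i + Suc n)))))"
    and small: "(\<Sum>i. exp (- (2 * \<theta>\<^sup>2) * real (\<sigma> (Suc (i + Suc n))))) \<le> 1 / 2"
    and lead: "\<And>x. S (hist n x) \<Longrightarrow> B n x \<le> R n x"
  shows "exp (- 31) / 2 * prob {x\<in>space M. S (hist n x)} \<le>
    prob {x\<in>space M. S (hist n x) \<and> (\<exists>N. \<forall>i\<ge>N. real (R i x) \<ge> (1 - \<epsilon>) * real (\<tau> i))}"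
proof -
  let ?D = "{x\<in>space M. S (hist n x)}"
  let ?T = "{x\<in>space M. S (hist n x) \<and> (\<exists>N. \<forall>i\<ge>N. real (R i x) \<ge> (1 - \<epsilon>) * real (\<tau> i))}"
  \<comment> \<open>Reached from \<open>R n x \<ge> \<tau> n / 2\<close> by a draw with at least
    \<open>\<sigma> (Suc n) / 2 + sqrt (\<sigma> (Suc n))\<close> red balls.\<close>
  define t where "t = real (\<tau> (Suc n)) / 2 + sqrt (real (\<sigma> (Suc n)))"
  have \<tau>_Suc: "\<tau> (Suc n) = \<tau> n + \<sigma> (Suc n)" by (simp add: \<tau>_def urn_total_def)
  let ?E = "{x\<in>space M. S (hist n x) \<and> real (R (Suc n) x) \<ge> t}"
  let ?bad = "\<lambda>i x. real (R (Suc i) x) < real (R i x) + (prob_red (R i x) (B i x) - \<theta>) * real (\<sigma> (Suc i))"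
  let ?Bad = "\<lambda>i. {x\<in>space M. S (hist n x) \<and> real (R (Suc n) x) \<ge> t \<and> ?bad i x}"
  have E: "exp (- 31) * prob ?D \<le> prob ?E"
  proof (rule prob_step_ge[where Q = "\<lambda>h m. real m \<ge> t"])
    show "AE x in M. S (hist n x) \<longrightarrow>
        exp (- 31) \<le> measure_pmf.prob (law_step n (R n x) (B n x)) {k. t \<le> real (R n x + k)}"
      using AE_total[of n]
    proof eventually_elim
      case (elim x)
      show ?case
      proof
        assume "S (hist n x)"
        then have le: "B n x \<le> R n x" by (rule lead)
        then have "w (B n x) \<le> w (R n x)" using w_mono by (auto simp: mono_def)
        then have p: "prob_red (R n x) (B n x) \<in> {1/2..1}"
          using w_pos[of "R n x"] w_pos[of "B n x"] by (auto simp: divide_simps)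
        have "real (\<tau> n) \<le> 2 * real (R n x)" using le elim by (simp flip: \<tau>_def)
        then have "{k. real k \<ge> real (\<sigma> (Suc n)) / 2 + sqrt (real (\<sigma> (Suc n)))} \<subseteq> {k. t \<le> real (R n x + k)}"
          by (auto simp: t_def \<tau>_Suc add_divide_distrib)
        then show "exp (- 31) \<le> measure_pmf.prob (law_step n (R n x) (B n x)) {k. t \<le> real (R n x + k)}"
          by (intro order_trans[OF tail[OF p]] measure_pmf.finite_measure_mono) auto
      qed
    qed
  qed
  have meas_bad [measurable]: "Measurable.pred M (?bad i)" for i
  proof -
    have "Measurable.pred M (\<lambda>x. (\<lambda>h m. real m < real (fst (last h)) + (prob_red (fst (last h)) (snd (last h)) - \<theta>) * real (\<sigma> (Suc i)))
        (hist i x) (R (Suc i) x))"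
      by measurable
    then show ?thesis by simp
  qed
  have Bad: "prob (?Bad i) \<le> exp (- (2 * \<theta>\<^sup>2) * real (\<sigma> (Suc i))) * prob ?E" if "i \<ge> Suc n" for i
  proof -
    \<comment> \<open>For \<open>i \<ge> Suc n\<close> the jump is part of the history, so it can be
      conditioned on. This makes the union bound relative to \<open>prob ?E\<close>, and at most
      half of \<open>?E\<close> is lost.\<close>
    define S' where "S' h \<longleftrightarrow> S (take (Suc n) h) \<and> real (fst (h ! Suc n)) \<ge> t" for h :: "(nat \<times> nat) list"
    have S': "S' (hist i x) \<longleftrightarrow> S (hist n x) \<and> real (R (Suc n) x) \<ge> t" for x
      using that by (simp add: S'_def take_hist nth_hist)
    define Q where "Q h m \<longleftrightarrow> real m < real (fst (last h)) + (prob_red (fst (last h)) (snd (last h)) - \<theta>) * real (\<sigma> (Suc i))"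
      for h :: "(nat \<times> nat) list" and m
    have "prob {x\<in>space M. S' (hist i x) \<and> Q (hist i x) (R (Suc i) x)} \<le>
        exp (- (2 * \<theta>\<^sup>2) * real (\<sigma> (Suc i))) * prob {x\<in>space M. S' (hist i x)}"
    proof (rule prob_step_le, rule AE_I2, rule impI)
      fix x
      have "{k. Q (hist i x) (R i x + k)} = {k. real k < (prob_red (R i x) (B i x) - \<theta>) * real (\<sigma> (Suc i))}"
        by (auto simp: Q_def)
      then show "measure_pmf.prob (law_step i (R i x) (B i x)) {k. Q (hist i x) (R i x + k)} \<le>
          exp (- (2 * \<theta>\<^sup>2) * real (\<sigma> (Suc i)))"
        using binomial_pmf_lower_tail[OF prob_red_in \<theta>] by simp
    qed
    then show ?thesis by (simp add: S' Q_def conj_assoc)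
  qed
  define U where "U = (\<Union>i. ?Bad (i + Suc n))"
  have U_sets: "U \<in> sets M" and E_sets: "?E \<in> sets M" and T_sets: "?T \<in> sets M"
    unfolding U_def by measurable
  have summE: "summable (\<lambda>i. exp (- (2 * \<theta>\<^sup>2) * real (\<sigma> (Suc (i + Suc n)))) * prob ?E)"
    using summ by (rule summable_mult2)
  have summB: "summable (\<lambda>i. prob (?Bad (i + Suc n)))"
    by (rule summable_comparison_test'[OF summE, of 0]) (use Bad in auto)
  have "prob U \<le> (\<Sum>i. prob (?Bad (i + Suc n)))"
    unfolding U_def by (intro finite_measure_subadditive_countably summB) auto
  also have "\<dots> \<le> (\<Sum>i. exp (- (2 * \<theta>\<^sup>2) * real (\<sigma> (Suc (i + Suc n)))) * prob ?E)"
    by (intro suminf_le summE summB) (use Bad in auto)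
  also have "\<dots> = (\<Sum>i. exp (- (2 * \<theta>\<^sup>2) * real (\<sigma> (Suc (i + Suc n))))) * prob ?E"
    using summ by (rule suminf_mult2[symmetric])
  also have "\<dots> \<le> 1 / 2 * prob ?E" using small by (intro mult_right_mono) auto
  finally have U: "prob U \<le> 1 / 2 * prob ?E" .
  have "prob (?E - U) = prob ?E - prob U"
    by (rule finite_measure_Diff) (use E_sets U_sets in \<open>auto simp: U_def\<close>)
  then have "exp (- 31) / 2 * prob ?D \<le> prob (?E - U)" using E U by simp
  also have "\<dots> \<le> prob ?T"
  proof (rule finite_measure_mono_AE[OF _ T_sets])
    have "AE x in M. \<forall>i. R i x + B i x = \<tau> i"
      unfolding AE_all_countable \<tau>_def using AE_total by auto
    then show "AE x in M. x \<in> ?E - U \<longrightarrow> x \<in> ?T"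
    proof eventually_elim
      case (elim x)
      show ?case
      proof
        assume x: "x \<in> ?E - U"
        have "\<not> ?bad i x" if "i \<ge> Suc n" for i
        proof -
          have "x \<notin> ?Bad ((i - Suc n) + Suc n)" using x unfolding U_def by blast
          then show ?thesis using x that by simp
        qed
        then have "eventually (\<lambda>i. real (R i x) \<ge> (1 - \<epsilon>) * real (\<tau> i)) sequentially"
          using x elim by (intro drift[of "Suc n" "\<lambda>i. R i x" "\<lambda>i. B i x"]) (auto simp: t_def not_less)
        then show "x \<in> ?T" using x by (auto simp: eventually_sequentially)
      qed
    qed
  qed
  finally show ?thesis .
qed

text \<open>Where red eventually dominates, blue is almost surely bounded, so unbounded blue is
  confined to the part of the history event without domination.\<close>

lemma prob_both_unbounded_le:
  defines "\<tau> \<equiv> urn_total R0 B0 \<sigma>"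
  assumes dom: "c * prob {x\<in>space M. S (hist n x)} \<le>
      prob {x\<in>space M. S (hist n x) \<and> (\<exists>N. \<forall>i\<ge>N. real (R i x) \<ge> (1 - \<epsilon>) * real (\<tau> i))}"
    and null: "\<And>N. prob {x\<in>space M. (\<forall>i\<ge>N. real (R i x) \<ge> (1 - \<epsilon>) * real (\<tau> i)) \<and> (\<forall>m. \<exists>i. B i x \<ge> m)} = 0"
  shows "prob {x\<in>space M. S (hist n x) \<and> (\<forall>m. \<exists>i. B i x \<ge> m)} \<le> (1 - c) * prob {x\<in>space M. S (hist n x)}"
proof -
  let ?D = "{x\<in>space M. S (hist n x)}"
  let ?T = "{x\<in>space M. S (hist n x) \<and> (\<exists>N. \<forall>i\<ge>N. real (R i x) \<ge> (1 - \<epsilon>) * real (\<tau> i))}"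
  have sets: "?D \<in> sets M" "?T \<in> sets M" by measurable
  have "AE x in M. \<forall>N. \<not> ((\<forall>i\<ge>N. real (R i x) \<ge> (1 - \<epsilon>) * real (\<tau> i)) \<and> (\<forall>m. \<exists>i. B i x \<ge> m))"
    unfolding AE_all_countable
  proof
    fix N
    have "{x\<in>space M. (\<forall>i\<ge>N. real (R i x) \<ge> (1 - \<epsilon>) * real (\<tau> i)) \<and> (\<forall>m. \<exists>i. B i x \<ge> m)} \<in> sets M"
      by measurable
    then show "AE x in M. \<not> ((\<forall>i\<ge>N. real (R i x) \<ge> (1 - \<epsilon>) * real (\<tau> i)) \<and> (\<forall>m. \<exists>i. B i x \<ge> m))"
      using null[of N] AE_space by (auto simp: prob_eq_0 elim!: eventually_elim2)
  qed
  then have "prob {x\<in>space M. S (hist n x) \<and> (\<forall>m. \<exists>i. B i x \<ge> m)} \<le> prob (?D - ?T)"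
    by (intro finite_measure_mono_AE) (use sets in \<open>auto elim!: eventually_mono\<close>)
  also have "\<dots> = prob ?D - prob ?T" by (rule finite_measure_Diff) (use sets in auto)
  also have "\<dots> \<le> (1 - c) * prob ?D" using dom by (simp add: algebra_simps)
  finally show ?thesis .
qed

end

section \<open>Both colours combined: almost surely one of them stays bounded\<close>

theorem theorem4p1:
  fixes M :: "'a measure"
    and w :: "nat \<Rightarrow> real"
    and \<sigma> :: "nat \<Rightarrow> nat"
    and R0 B0 :: nat
    and R B :: "nat \<Rightarrow> 'a \<Rightarrow> nat"
  defines "\<tau> \<equiv> urn_total R0 B0 \<sigma>"
    and "W \<equiv> lin_interp w"
  assumes "gpu_process M w \<sigma> R0 B0 R B"
    and "summable (\<lambda>n. 1 / w n)"
    and "\<forall>\<kappa>>0. summable (\<lambda>n. exp (- \<kappa> * real (\<sigma> (Suc n))))"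
    and "liminf (\<lambda>n. ereal (W (real (\<tau> n) / 2 + sqrt (real (\<sigma> n))) / W (real (\<tau> n) / 2))) > 1"
    and "\<forall>\<epsilon>>0. \<exists>\<delta>>0. \<forall>\<gamma>\<ge>1 + \<epsilon>.
           Liminf at_top (\<lambda>x. ereal (W (\<gamma> * x) / W x)) \<ge> ereal (\<gamma> + \<delta>)"
    and "\<exists>\<epsilon>::real. 0 < \<epsilon> \<and> \<epsilon> < 1 \<and> (\<exists>n0. \<forall>n\<ge>n0.
           (\<Sum>\<^sub>\<infinity>i\<in>{n..}. ennreal (real (\<sigma> (Suc i)) / W ((1 - \<epsilon>) * real (\<tau> i))))
             \<le> ennreal (1 / 4) * (\<Sum>\<^sub>\<infinity>i\<in>{nat \<lfloor>\<epsilon> * real (\<tau> n)\<rfloor>..}. ennreal (1 / w i)))"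
  shows "\<P>(x in M. lim (\<lambda>n. enat (R n x)) < \<infinity> \<or> lim (\<lambda>n. enat (B n x)) < \<infinity>) = 1"
proof -
  interpret P: gpu_process M w \<sigma> R0 B0 R B by fact
  interpret Q: gpu_process M w \<sigma> B0 R0 B R by (rule P.gpu_process_swap)
  have \<tau>_swap: "urn_total B0 R0 \<sigma> = \<tau>" by (simp add: \<tau>_def urn_total_def fun_eq_iff)
  note [measurable] = P.R_meas P.B_meas
  obtain \<epsilon> n0 where \<epsilon>: "0 < \<epsilon>" "\<epsilon> < 1" and iv: "\<And>n. n \<ge> n0 \<Longrightarrow>
      (\<Sum>\<^sub>\<infinity>i\<in>{n..}. ennreal (real (\<sigma> (Suc i)) / W ((1 - \<epsilon>) * real (\<tau> i))))
        \<le> ennreal (1 / 4) * (\<Sum>\<^sub>\<infinity>i\<in>{nat \<lfloor>\<epsilon> * real (\<tau> n)\<rfloor>..}. ennreal (1 / w i))"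
    using assms(8) by blast
  have \<sigma>_Suc_lim: "filterlim (\<lambda>n. \<sigma> (Suc n)) at_top sequentially"
  proof -
    have "summable (\<lambda>n. exp (- 1 * real (\<sigma> (Suc n))))" using assms(5) zero_less_one by blast
    then have lim: "(\<lambda>n. exp (- 1 * real (\<sigma> (Suc n)))) \<longlonglongrightarrow> 0" by (rule summable_LIMSEQ_zero)
    show ?thesis
      unfolding filterlim_at_top
    proof
      fix K :: nat
      have "eventually (\<lambda>n. exp (- 1 * real (\<sigma> (Suc n))) < exp (- real K)) sequentially"
        using lim by (rule order_tendstoD) simp
      then show "eventually (\<lambda>n. K \<le> \<sigma> (Suc n)) sequentially" by eventually_elim simp
    qed
  qed
  then have \<sigma>_lim: "filterlim \<sigma> at_top sequentially" by (subst (asm) filterlim_sequentially_Suc)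
  obtain \<theta> n1 where \<theta>: "\<theta> > 0" and drift: "\<And>n r b. n \<ge> n1 \<Longrightarrow> \<forall>i\<ge>n. r i + b i = \<tau> i \<Longrightarrow>
       real (r n) \<ge> real (\<tau> n) / 2 + sqrt (real (\<sigma> n)) \<Longrightarrow>
       \<forall>i\<ge>n. real (r (Suc i)) \<ge> real (r i) + (w (r i) / (w (r i) + w (b i)) - \<theta>) * real (\<sigma> (Suc i)) \<Longrightarrow>
       eventually (\<lambda>i. real (r i) \<ge> (1 - \<epsilon>) * real (\<tau> i)) sequentially"
    by (rule dominance_of_drift[of w \<tau> \<sigma> \<epsilon>])
       (use P.w_pos P.w_mono \<sigma>_lim assms(6,7) \<epsilon> in \<open>auto simp: W_def \<tau>_def urn_total_def\<close>)
  define s where "s n = exp (- (2 * \<theta>\<^sup>2) * real (\<sigma> (Suc n)))" for n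
  have s: "summable s" unfolding s_def using assms(5) \<theta> by (metis mult_pos_pos zero_less_numeral zero_less_power)
  obtain n2 where n2: "\<And>n. n \<ge> n2 \<Longrightarrow> norm (\<Sum>i. s (i + n)) < 1 / 2"
    using suminf_exist_split[OF _ s, of "1 / 2"] by auto
  obtain n3 where n3: "\<And>n p. n \<ge> n3 \<Longrightarrow> p \<in> {1/2..1} \<Longrightarrow> measure_pmf.prob (binomial_pmf (\<sigma> (Suc n)) p)
        {k. real k \<ge> real (\<sigma> (Suc n)) / 2 + sqrt (real (\<sigma> (Suc n)))} \<ge> exp (- 31)"
    using eventually_compose_filterlim[OF binomial_pmf_upper_tail \<sigma>_Suc_lim]
    unfolding eventually_sequentially by blast
  have P_null: "P.prob {x\<in>space M. (\<forall>i\<ge>N. real (R i x) \<ge> (1 - \<epsilon>) * real (\<tau> i)) \<and> (\<forall>m. \<exists>i. B i x \<ge> m)} = 0" for N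
    using Q.prob_dominated_unbounded[of \<epsilon> n0 N] \<epsilon> assms(4) iv by (simp add: \<tau>_swap W_def)
  have Q_null: "P.prob {x\<in>space M. (\<forall>i\<ge>N. real (B i x) \<ge> (1 - \<epsilon>) * real (\<tau> i)) \<and> (\<forall>m. \<exists>i. R i x \<ge> m)} = 0" for N
    using P.prob_dominated_unbounded[of \<epsilon> n0 N] \<epsilon> assms(4) iv by (simp add: \<tau>_def W_def)
  let ?c = "exp (- 31) / 2 :: real"
  let ?n = "max n1 (max n2 n3)"
  let ?Z = "{x\<in>space M. (\<forall>m. \<exists>i. R i x \<ge> m) \<and> (\<forall>m. \<exists>i. B i x \<ge> m)}"
  \<comment> \<open>Shifted to \<open>Suc n\<close>: the draw at time \<open>n\<close> creates the
    lead, and only deviations after it are summed.\<close>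
  have noise: "summable (\<lambda>i. exp (- (2 * \<theta>\<^sup>2) * real (\<sigma> (Suc (i + Suc n)))))"
      "(\<Sum>i. exp (- (2 * \<theta>\<^sup>2) * real (\<sigma> (Suc (i + Suc n))))) \<le> 1 / 2" if "n \<ge> ?n" for n
    using s n2[of "Suc n"] that summable_ignore_initial_segment[OF s, of "Suc n"] by (auto simp: s_def)
  have "P.prob ?Z = 0"
  proof (rule P.null_event_if_small_given_hist)
    show "?Z \<in> sigma_sets (space M) P.hist_events"
    proof -
      note [measurable] = P.measurable_hist_events
      have "{x\<in>space (sigma (space M) P.hist_events). (\<forall>m. \<exists>i. R i x \<ge> m) \<and> (\<forall>m. \<exists>i. B i x \<ge> m)}
          \<in> sets (sigma (space M) P.hist_events)"
        by measurable
      then show ?thesis by (simp add: P.sigma_hist_events)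
    qed
    show "1 - ?c < 1" by simp
    fix n S assume n: "n \<ge> ?n"
    define SP where "SP h \<longleftrightarrow> S h \<and> snd (last h) \<le> fst (last h)" for h :: "(nat \<times> nat) list"
    \<comment> \<open>The exchanged process lists the pairs as (blue, red), hence
      \<open>prod.swap\<close>. Ties go to \<open>SP\<close>, so the two cases are disjoint and
      exhaust \<open>S\<close>.\<close>
    define SQ where "SQ h \<longleftrightarrow> S (map prod.swap h) \<and> snd (last h) < fst (last h)" for h :: "(nat \<times> nat) list"
    have swap: "map prod.swap (Q.hist n x) = P.hist n x" for x by (simp add: P.hist_def Q.hist_def)
    have "P.prob {x\<in>space M. SP (P.hist n x) \<and> (\<forall>m. \<exists>i. B i x \<ge> m)} \<le> (1 - ?c) * P.prob {x\<in>space M. SP (P.hist n x)}"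
    proof (rule P.prob_both_unbounded_le[of _ _ _ \<epsilon>], fold \<tau>_def)
      show "?c * P.prob {x\<in>space M. SP (P.hist n x)} \<le>
          P.prob {x\<in>space M. SP (P.hist n x) \<and> (\<exists>N. \<forall>i\<ge>N. real (R i x) \<ge> (1 - \<epsilon>) * real (\<tau> i))}"
      proof (rule P.prob_dominance_ge[OF \<theta>, folded \<tau>_def], rule drift)
        show "n1 \<le> m" if "n \<le> m" for m using n that by simp
      qed (assumption, use n n3 noise in \<open>auto simp: SP_def\<close>)
    qed (rule P_null)
    moreover have "P.prob {x\<in>space M. SQ (Q.hist n x) \<and> (\<forall>m. \<exists>i. R i x \<ge> m)} \<le> (1 - ?c) * P.prob {x\<in>space M. SQ (Q.hist n x)}"
    proof (rule Q.prob_both_unbounded_le[of _ _ _ \<epsilon>], unfold \<tau>_swap)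
      show "?c * P.prob {x\<in>space M. SQ (Q.hist n x)} \<le>
          P.prob {x\<in>space M. SQ (Q.hist n x) \<and> (\<exists>N. \<forall>i\<ge>N. real (B i x) \<ge> (1 - \<epsilon>) * real (\<tau> i))}"
      proof (rule Q.prob_dominance_ge[OF \<theta>, unfolded \<tau>_swap], rule drift)
        show "n1 \<le> m" if "n \<le> m" for m using n that by simp
      qed (assumption, use n n3 noise in \<open>auto simp: SQ_def\<close>)
    qed (rule Q_null)
    moreover have "P.prob {x\<in>space M. S (P.hist n x)} =
        P.prob {x\<in>space M. SP (P.hist n x)} + P.prob {x\<in>space M. SQ (Q.hist n x)}"
    proof -
      have "{x\<in>space M. S (P.hist n x)} = {x\<in>space M. SP (P.hist n x)} \<union> {x\<in>space M. SQ (Q.hist n x)}"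
        and "{x\<in>space M. SP (P.hist n x)} \<inter> {x\<in>space M. SQ (Q.hist n x)} = {}"
        by (auto simp: SP_def SQ_def swap)
      moreover have "{x\<in>space M. SP (P.hist n x)} \<in> sets M" "{x\<in>space M. SQ (Q.hist n x)} \<in> sets M"
        by measurable
      ultimately show ?thesis by (simp only: P.finite_measure_Union)
    qed
    moreover have "P.prob (?Z \<inter> {x\<in>space M. S (P.hist n x)}) \<le>
        P.prob ({x\<in>space M. SP (P.hist n x) \<and> (\<forall>m. \<exists>i. B i x \<ge> m)} \<union>
          {x\<in>space M. SQ (Q.hist n x) \<and> (\<forall>m. \<exists>i. R i x \<ge> m)})"
    proof (rule P.finite_measure_mono)
      show "?Z \<inter> {x\<in>space M. S (P.hist n x)} \<subseteq> {x\<in>space M. SP (P.hist n x) \<and> (\<forall>m. \<exists>i. B i x \<ge> m)} \<union>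
          {x\<in>space M. SQ (Q.hist n x) \<and> (\<forall>m. \<exists>i. R i x \<ge> m)}"
        by (auto simp: SP_def SQ_def swap)
    qed measurable
    moreover have "\<dots> \<le> P.prob {x\<in>space M. SP (P.hist n x) \<and> (\<forall>m. \<exists>i. B i x \<ge> m)} +
          P.prob {x\<in>space M. SQ (Q.hist n x) \<and> (\<forall>m. \<exists>i. R i x \<ge> m)}"
      by (rule measure_Un_le) measurable
    ultimately show "P.prob (?Z \<inter> {x\<in>space M. S (P.hist n x)}) \<le> (1 - ?c) * P.prob {x\<in>space M. S (P.hist n x)}"
      by (simp add: distrib_left)
  qed
  moreover have "?Z \<in> sets M" by measurable
  ultimately have "AE x in M. x \<notin> ?Z" by (simp add: P.prob_eq_0)
  moreover have "AE x in M. \<forall>i. R i x \<le> R (Suc i) x"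
    unfolding AE_all_countable using P.AE_step by (auto elim!: eventually_mono)
  moreover have "AE x in M. \<forall>i. B i x \<le> B (Suc i) x"
    unfolding AE_all_countable using Q.AE_step by (auto elim!: eventually_mono)
  ultimately have "AE x in M. lim (\<lambda>n. enat (R n x)) < \<infinity> \<or> lim (\<lambda>n. enat (B n x)) < \<infinity>"
    using AE_space
  proof eventually_elim
    case (elim x)
    then obtain K where "(\<forall>i. R i x < K) \<or> (\<forall>i. B i x < K)" by (auto simp: not_le)
    then show ?case using elim lim_enat_finite_if_bounded[of "\<lambda>i. R i x" K] lim_enat_finite_if_bounded[of "\<lambda>i. B i x" K]
      by blast
  qed
  \<comment> \<open>The event has to be measurable on all of \<open>space M\<close>, including a
    null set of paths without monotonicity, where \<open>lim\<close> may be a default value.\<close>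
  moreover have "{x\<in>space M. lim (\<lambda>n. enat (R n x)) < \<infinity> \<or> lim (\<lambda>n. enat (B n x)) < \<infinity>} \<in> sets M"
    unfolding lim_enat_finite_iff by measurable
  ultimately show ?thesis by (subst P.prob_Collect_eq_1)
qed

end
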